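(* Let $m\ge 2$ and, for $n\ge 1$, let $\mathbf X_n=(X_n^{(1)},\dots,X_n^{(2m-2)})$ be the vector of gap counts of the random $m$-ary search tree on $n$ keys. Then, almost surely and componentwise, $$\frac1n\mathbf X_n\longrightarrow \mathbf v,$$ where $v_i=\dfrac{i}{m(m+1)(H_m-1)}$ for $1\le i\le m$ and $v_{m+j}=\dfrac{1}{(j+2)(H_m-1)}$ for $1\le j\le m-2$.
   Context: Fix an integer $m\ge 2$. The random $m$-ary search tree on $n$ keys is built by inserting, one at a time, the entries of a uniformly random permutation of $\{1,\dots,n\}$ into an initially empty tree: each node stores at most $m-1$ keys in sorted order; the first key creates the root; a key reaching a node holding fewer than $m-1$ keys is stored in that node; a key reaching a node holding $m-1$ keys $x_1<\dots<x_{m-1}$ is sent to the $j$-th subtree of that node ($1\le j\le m$), where $x_{j-1}<\text{key}<x_j$ with $x_0=-\infty$, $x_m=+\infty$, and inserted recursively there (creating a new node if that subtree is empty). Gaps (insertion positions) are classified into types $1,\dots,2m-2$: a node holding $m-1$ keys and having exactly $i$ empty subtrees ($1\le i\le m$) contributes $i$ gaps of type $i$; a node holding $j$ keys with $1\le j\le m-2$ (necessarily a leaf) contributes $j+1$ gaps of type $m+j$. $X_n^{(i)}$ is the total number of gaps of type $i$ in the tree after $n$ insertions. $H_m=\sum_{r=1}^m 1/r$. *)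

theory Defs
  imports "HOL-Probability.Probability"
begin

text \<open>m-ary search trees with real keys. A node stores its keys as a sorted list
  and always carries exactly m child slots (Leaf = empty subtree); children of a
  node holding fewer than m-1 keys are all Leaf.\<close>

datatype mtree = Leaf | Node "real list" "mtree list"

lemma mtree_size_child_aux: "c \<in> set cs \<Longrightarrow> size c < Suc (size_list size cs)"
  by (simp add: le_imp_less_Suc size_list_estimation')

function ins :: "nat \<Rightarrow> real \<Rightarrow> mtree \<Rightarrow> mtree" where
  "ins m x Leaf = Node [x] (replicate m Leaf)"
| "ins m x (Node ks cs) =
     (if length ks < m - 1 then Node (insort x ks) cs
      else (let j = length (filter (\<lambda>k. k < x) ks)
            in Node ks (map (\<lambda>(i, c). if i = j then ins m x c else c)
                            (zip [0..<length cs] cs))))"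
  by pat_completeness auto
termination
  by (relation "Wellfounded.measure (\<lambda>(m, x, t). size t)")
     (auto dest!: set_zip_rightD intro: mtree_size_child_aux)

definition build :: "nat \<Rightarrow> nat \<Rightarrow> (nat \<Rightarrow> real) \<Rightarrow> mtree" where
  "build m n x = fold (ins m) (map x [0..<n]) Leaf"

fun gaps :: "nat \<Rightarrow> nat \<Rightarrow> mtree \<Rightarrow> nat" where
  "gaps m i Leaf = 0"
| "gaps m i (Node ks cs) =
     (if length ks = m - 1
      then (let e = length (filter (\<lambda>c. c = Leaf) cs) in if i = e \<and> 1 \<le> e then e else 0)
      else (if 1 \<le> length ks \<and> i = m + length ks then length ks + 1 else 0))
     + sum_list (map (gaps m i) cs)"

definition harmonic :: "nat \<Rightarrow> real" where
  "harmonic m = (\<Sum>r=1..m. 1 / real r)"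

definition limvec :: "nat \<Rightarrow> nat \<Rightarrow> real" where
  "limvec m i = (if i \<le> m then real i / (real m * (real m + 1) * (harmonic m - 1))
                 else 1 / ((real (i - m) + 2) * (harmonic m - 1)))"

end

theory Submission
  imports Defs
begin

text \<open>
  Number the gap types by the age of their node: level \<open>p < m - 1\<close> is a leaf with \<open>p\<close> keys, and the
  levels \<open>m - 1, \<dots>, 2 m - 2\<close> are full nodes with \<open>m, \<dots>, 1\<close> empty subtrees. The ranks of the keys
  are exchangeable, so a new key hits each of the \<open>n + 1\<close> gaps with equal probability, and the gap
  vector \<open>X\<close> is an urn whose replacement matrix \<open>R\<close> has row sums 1 and nonnegative off-diagonal
  entries: \<open>R - I\<close> generates a Markov chain that moves up the levels, with stationary law \<open>v\<close>.
  For the deviation \<open>D = \<Sum> (X - (n+1) v)\<^sup>2 / v\<close>, the Dirichlet form of that chain and the Poincare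
  inequality on a path yield \<open>E D(n+1) \<le> (1 + 2 (1 - c) / (n+1)) E D(n) + C\<close> with \<open>c > 0\<close>, hence
  \<open>\<Sum> E D(n) / (n+1)\<^sup>3 < \<infinity>\<close>. So almost surely \<open>u = X / (n+1) - v\<close> satisfies \<open>\<Sum> u\<^sup>2 / n < \<infinity>\<close>.
  As \<open>u\<close> changes by \<open>O(1/n)\<close> in each step, the increments of \<open>u\<^sup>3\<close> are summable, which forces
  \<open>u \<rightarrow> 0\<close>; neither martingale convergence nor the eigenvalues of \<open>R\<close> are needed.
\<close>

section \<open>Urns with a stationary distribution\<close>

text \<open>With \<open>f = D / v\<close> this is the squared norm of \<open>f\<close> in L2(v). In
  this weighting the linear drift of the urn becomes a Dirichlet form, with no symmetry asked of
  \<open>R\<close>.\<close>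

definition chi_square :: "nat \<Rightarrow> (nat \<Rightarrow> real) \<Rightarrow> (nat \<Rightarrow> real) \<Rightarrow> real" where
  "chi_square N v D = (\<Sum>k=1..N. (D k)\<^sup>2 / v k)"

text \<open>Telescope \<open>f\<close> along the path between the two points and apply
  Cauchy-Schwarz against the constant 1; the path has fewer than \<open>N\<close> edges.\<close>

lemma diff_square_le_path:
  fixes f :: "nat \<Rightarrow> real"
  assumes "1 \<le> p" "p \<le> N" "1 \<le> q" "q \<le> N"
  shows "(f p - f q)\<^sup>2 \<le> real N * (\<Sum>k=1..<N. (f (Suc k) - f k)\<^sup>2)"
proof -
  have *: "(f p - f q)\<^sup>2 \<le> real N * (\<Sum>k=1..<N. (f (Suc k) - f k)\<^sup>2)"
    if "1 \<le> p" "p \<le> q" "q \<le> N" for p q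
  proof -
    have "f q - f p = (\<Sum>k=p..<q. f (Suc k) - f k)"
      using that by (simp add: sum_Suc_diff')
    then have "(f p - f q)\<^sup>2 = (\<Sum>k=p..<q. 1 * (f (Suc k) - f k))\<^sup>2"
      by (subst power2_commute) simp
    also have "\<dots> \<le> (\<Sum>k=p..<q. 1\<^sup>2) * (\<Sum>k=p..<q. (f (Suc k) - f k)\<^sup>2)"
      by (rule Cauchy_Schwarz_ineq_sum)
    also have "\<dots> \<le> real N * (\<Sum>k=1..<N. (f (Suc k) - f k)\<^sup>2)"
      using that by (intro mult_mono sum_mono2) (auto intro!: sum_nonneg)
    finally show ?thesis .
  qed
  show ?thesis
    using *[of p q] *[of q p] assms by (cases "p \<le> q") (auto simp: power2_commute)
qed

text \<open>Poincare inequality on a path. For a probability vector \<open>v\<close> and a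
  \<open>v\<close>-centred \<open>f\<close>, twice the second moment is the mean of
  \<open>(f p - f q)^2\<close> over two independent draws from \<open>v\<close>, and each such
  square is bounded by the path energy.\<close>

lemma variance_le_path:
  fixes f v :: "nat \<Rightarrow> real"
  assumes "\<And>p. p \<in> {1..N} \<Longrightarrow> 0 < v p" "(\<Sum>p=1..N. v p) = 1" "(\<Sum>p=1..N. v p * f p) = 0"
  shows "2 * (\<Sum>p=1..N. v p * (f p)\<^sup>2) \<le> real N * (\<Sum>k=1..<N. (f (Suc k) - f k)\<^sup>2)"
    (is "_ \<le> ?S")
proof -
  have "2 * (\<Sum>p=1..N. v p * (f p)\<^sup>2)
      = (\<Sum>p=1..N. v p * (f p)\<^sup>2) * (\<Sum>q=1..N. v q)
        + (\<Sum>p=1..N. v p) * (\<Sum>q=1..N. v q * (f q)\<^sup>2)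
        - 2 * ((\<Sum>p=1..N. v p * f p) * (\<Sum>q=1..N. v q * f q))"
    using assms by simp
  also have "\<dots> = (\<Sum>p=1..N. \<Sum>q=1..N. v p * v q * (f p - f q)\<^sup>2)"
    unfolding sum_product unfolding sum_distrib_left sum.distrib[symmetric] sum_subtractf[symmetric]
    by (intro sum.cong) (auto simp: power2_eq_square algebra_simps)
  also have "\<dots> \<le> (\<Sum>p=1..N. \<Sum>q=1..N. v p * v q * ?S)"
    using assms(1) by (intro sum_mono mult_left_mono diff_square_le_path) (auto simp: less_imp_le)
  also have "\<dots> = (\<Sum>p=1..N. v p) * (\<Sum>q=1..N. v q) * ?S"
    unfolding sum_product unfolding sum_distrib_right ..
  finally show ?thesis using assms(2) by simp
qed

text \<open>Drawing a ball of type \<open>p\<close> changes the urn by row \<open>p\<close> of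
  \<open>R\<close>: one ball more in total by \<open>rows\<close>, and \<open>v\<close> is a fixed
  direction by \<open>stat\<close>. The edges from \<open>link\<close> form a path through all
  types, so a Poincare inequality is available even for a non-reversible chain.\<close>

locale urn_chain =
  fixes N :: nat and v :: "nat \<Rightarrow> real" and R :: "nat \<Rightarrow> nat \<Rightarrow> real"
  assumes v_pos: "\<And>p. p \<in> {1..N} \<Longrightarrow> 0 < v p"
    and v_sum: "(\<Sum>p=1..N. v p) = 1"
    and rows: "\<And>p. p \<in> {1..N} \<Longrightarrow> (\<Sum>q=1..N. R p q) = 1"
    and stat: "\<And>q. q \<in> {1..N} \<Longrightarrow> (\<Sum>p=1..N. v p * R p q) = v q"
    and off: "\<And>p q. p \<in> {1..N} \<Longrightarrow> q \<in> {1..N} \<Longrightarrow> p \<noteq> q \<Longrightarrow> 0 \<le> R p q"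
    and link: "\<And>p. p \<in> {1..<N} \<Longrightarrow> 0 < R p (Suc p)"
begin

text \<open>Expand the square in the Dirichlet form with \<open>D = v f\<close>. The two pure terms
  both give the chi-square, one by \<open>rows\<close> and one by \<open>stat\<close>; the mixed
  term is the quadratic form of \<open>R\<close>. Diagonal entries of \<open>R\<close>, which may be
  negative, multiply a zero square.\<close>

lemma dirichlet_identity:
  "(\<Sum>q=1..N. (\<Sum>p=1..N. D p * R p q) * D q / v q)
   = chi_square N v D - (\<Sum>p=1..N. \<Sum>q=1..N. v p * R p q * (D p / v p - D q / v q)\<^sup>2) / 2"
proof -
  define f where "f p = D p / v p" for p
  have D: "D p = v p * f p" if "p \<in> {1..N}" for p
    using v_pos[OF that] by (simp add: f_def)
  have chi: "chi_square N v D = (\<Sum>p=1..N. v p * (f p)\<^sup>2)"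
    unfolding chi_square_def using v_pos
    by (intro sum.cong) (auto simp: f_def power2_eq_square field_simps)
  have 1: "(\<Sum>p=1..N. \<Sum>q=1..N. v p * R p q * (f p)\<^sup>2) = chi_square N v D"
  proof -
    have "(\<Sum>q=1..N. v p * R p q * (f p)\<^sup>2) = v p * (f p)\<^sup>2" if "p \<in> {1..N}" for p
      using rows[OF that] by (simp flip: sum_distrib_left sum_distrib_right)
    then show ?thesis by (simp add: chi)
  qed
  have 2: "(\<Sum>p=1..N. \<Sum>q=1..N. v p * R p q * (f q)\<^sup>2) = chi_square N v D"
  proof -
    have "(\<Sum>p=1..N. v p * R p q * (f q)\<^sup>2) = v q * (f q)\<^sup>2" if "q \<in> {1..N}" for q
      using stat[OF that] by (simp flip: sum_distrib_right)
    then show ?thesis by (subst sum.swap) (simp add: chi)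
  qed
  have 3: "(\<Sum>q=1..N. (\<Sum>p=1..N. D p * R p q) * D q / v q)
      = (\<Sum>p=1..N. \<Sum>q=1..N. v p * R p q * (f p * f q))"
  proof (subst sum.swap[of "\<lambda>p q. v p * R p q * (f p * f q)"], intro sum.cong refl)
    fix q
    have "(\<Sum>p=1..N. D p * R p q) * D q / v q = (\<Sum>p=1..N. D p * R p q * f q)"
      by (simp add: f_def sum_distrib_right sum_divide_distrib)
    then show "(\<Sum>p=1..N. D p * R p q) * D q / v q = (\<Sum>p=1..N. v p * R p q * (f p * f q))"
      using D by (auto simp: mult_ac intro!: sum.cong)
  qed
  have "(\<Sum>p=1..N. \<Sum>q=1..N. v p * R p q * (f p - f q)\<^sup>2)
     = (\<Sum>p=1..N. \<Sum>q=1..N. v p * R p q * (f p)\<^sup>2) + (\<Sum>p=1..N. \<Sum>q=1..N. v p * R p q * (f q)\<^sup>2)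
       - 2 * (\<Sum>p=1..N. \<Sum>q=1..N. v p * R p q * (f p * f q))"
    unfolding sum_distrib_left sum.distrib[symmetric] sum_subtractf[symmetric]
    by (intro sum.cong) (auto simp: power2_eq_square algebra_simps)
  then show ?thesis
    unfolding f_def[symmetric] using 1 2 3 by linarith
qed

text \<open>In the Dirichlet form only the edges from \<open>p\<close> to \<open>p + 1\<close> are
  kept; by \<open>variance_le_path\<close> they already control the chi-square of a centred
  \<open>D\<close>.\<close>

lemma spectral_gap:
  obtains c where "0 < c" "c \<le> 1/3"
    "\<And>D. (\<Sum>p=1..N. D p) = 0 \<Longrightarrow>
       (\<Sum>q=1..N. (\<Sum>p=1..N. D p * R p q) * D q / v q) \<le> (1 - c) * chi_square N v D"
proof -
  have N: "N \<ge> 1"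
    using v_sum by (cases N) auto
  \<comment> \<open>The least edge weight; the inserted 1 keeps the set nonempty when
    \<open>N = 1\<close>.\<close>
  define e where "e = Min (insert 1 ((\<lambda>p. v p * R p (Suc p)) ` {1..<N}))"
  have e0: "e > 0"
    unfolding e_def using v_pos link by (subst Min_gr_iff) auto
  have e1: "e \<le> v p * R p (Suc p)" if "p \<in> {1..<N}" for p
    unfolding e_def using that by (intro Min_le) auto
  \<comment> \<open>Half of the Dirichlet form is at least \<open>e S / 2\<close>, which the
    Poincare inequality bounds below by \<open>e / N\<close> times the chi-square. The cap 1/3 puts
    the rate into the range that \<open>summable_of_drift\<close> takes.\<close>
  define c where "c = min (1/3) (e / N)"
  show thesis
  proof
    show "0 < c" using e0 N by (simp add: c_def)
    show "c \<le> 1/3" unfolding c_def by (rule min.cobounded1)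
  next
    fix D :: "nat \<Rightarrow> real" assume D0: "(\<Sum>p=1..N. D p) = 0"
    define f where "f p = D p / v p" for p
    define S where "S = (\<Sum>k=1..<N. (f (Suc k) - f k)\<^sup>2)"
    have chi: "chi_square N v D = (\<Sum>p=1..N. v p * (f p)\<^sup>2)"
      unfolding chi_square_def using v_pos
      by (intro sum.cong) (auto simp: f_def power2_eq_square field_simps)
    have "(\<Sum>p=1..N. v p * f p) = (\<Sum>p=1..N. D p)"
      using v_pos by (intro sum.cong) (auto simp: f_def less_imp_neq[symmetric])
    then have P: "2 * chi_square N v D \<le> N * S"
      unfolding chi S_def using v_pos v_sum D0 by (intro variance_le_path) auto
    have chi0: "chi_square N v D \<ge> 0"
      unfolding chi using v_pos by (intro sum_nonneg) (auto simp: less_imp_le)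
    have "e * S \<le> (\<Sum>p=1..<N. v p * R p (Suc p) * (f p - f (Suc p))\<^sup>2)"
      unfolding S_def sum_distrib_left
      using e1 by (intro sum_mono) (simp add: power2_commute mult_right_mono)
    also have "\<dots> \<le> (\<Sum>p=1..<N. \<Sum>q=1..N. v p * R p q * (f p - f q)\<^sup>2)"
    proof (intro sum_mono)
      fix p assume p: "p \<in> {1..<N}"
      have nn: "0 \<le> v p * R p q * (f p - f q)\<^sup>2" if "q \<in> {1..N}" for q
        using off[of p q] v_pos[of p] p that by (cases "p = q") (auto simp: less_imp_le)
      show "v p * R p (Suc p) * (f p - f (Suc p))\<^sup>2 \<le> (\<Sum>q=1..N. v p * R p q * (f p - f q)\<^sup>2)"
        using p by (intro member_le_sum[where f="\<lambda>q. v p * R p q * (f p - f q)\<^sup>2"] nn) auto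
    qed
    also have "\<dots> \<le> (\<Sum>p=1..N. \<Sum>q=1..N. v p * R p q * (f p - f q)\<^sup>2)"
    proof (intro sum_mono2)
      fix p assume p: "p \<in> {1..N} - {1..<N}"
      have nn: "0 \<le> v p * R p q * (f p - f q)\<^sup>2" if "q \<in> {1..N}" for q
        using off[of p q] v_pos[of p] p that by (cases "p = q") (auto simp: less_imp_le)
      then show "0 \<le> (\<Sum>q=1..N. v p * R p q * (f p - f q)\<^sup>2)"
        by (intro sum_nonneg) auto
    qed auto
    finally have E: "e * S \<le> (\<Sum>p=1..N. \<Sum>q=1..N. v p * R p q * (f p - f q)\<^sup>2)" .
    have "2 * (c * chi_square N v D) \<le> 2 * (e / N * chi_square N v D)"
      using chi0 by (intro mult_left_mono mult_right_mono) (auto simp: c_def)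
    also have "\<dots> = e / N * (2 * chi_square N v D)" by simp
    also have "\<dots> \<le> e / N * (N * S)"
      using P e0 by (intro mult_left_mono) auto
    also have "\<dots> = e * S" using N by simp
    finally show "(\<Sum>q=1..N. (\<Sum>p=1..N. D p * R p q) * D q / v q) \<le> (1 - c) * chi_square N v D"
      using E dirichlet_identity[of D] by (simp add: f_def algebra_simps)
  qed
qed

text \<open>For \<open>T > 0\<close>, \<open>X q / T\<close> is the probability of drawing type
  \<open>q\<close>, so the left side is \<open>T\<close> times the mean squared deviation after one
  draw. Expand the square: in the linear part the \<open>T v\<close> portion of \<open>X\<close>
  cancels by \<open>stat\<close>, leaving the form of the centred \<open>D\<close> for
  \<open>spectral_gap\<close>; the quadratic part is bounded by a constant.\<close>

lemma urn_drift:
  obtains c C where "0 < c" "c \<le> 1/3" "0 \<le> C"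
    "\<And>X T. (\<And>q. q \<in> {1..N} \<Longrightarrow> 0 \<le> X q) \<Longrightarrow> (\<Sum>q=1..N. X q) = T \<Longrightarrow>
       (\<Sum>q=1..N. X q * chi_square N v (\<lambda>k. X k + R q k - (T + 1) * v k))
       \<le> (T + 2 * (1 - c)) * chi_square N v (\<lambda>k. X k - T * v k) + T * C"
proof -
  obtain c where c: "0 < c" "c \<le> 1/3"
    "\<And>D. (\<Sum>p=1..N. D p) = 0 \<Longrightarrow>
       (\<Sum>q=1..N. (\<Sum>p=1..N. D p * R p q) * D q / v q) \<le> (1 - c) * chi_square N v D"
    by (rule spectral_gap) blast
  define V where "V q = chi_square N v (\<lambda>k. R q k - v k)" for q
  have V0: "V q \<ge> 0" for q
    unfolding V_def chi_square_def using v_pos by (intro sum_nonneg divide_nonneg_pos) auto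
  define C where "C = (\<Sum>q=1..N. V q)"
  have VC: "V q \<le> C" if "q \<in> {1..N}" for q
    unfolding C_def using that V0 by (intro member_le_sum) auto
  show thesis
  proof
    show "0 < c" "c \<le> 1/3" "0 \<le> C" using c V0 by (auto simp: C_def sum_nonneg)
  next
    fix X :: "nat \<Rightarrow> real" and T
    assume X0: "\<And>q. q \<in> {1..N} \<Longrightarrow> 0 \<le> X q" and XT: "(\<Sum>q=1..N. X q) = T"
    define D where "D k = X k - T * v k" for k
    have D0: "(\<Sum>q=1..N. D q) = 0"
      using XT v_sum by (simp add: D_def sum_subtractf flip: sum_distrib_left)
    have XR: "(\<Sum>q=1..N. X q * R q k) = (\<Sum>q=1..N. D q * R q k) + T * v k" if "k \<in> {1..N}" for k
    proof -
      have "(\<Sum>q=1..N. X q * R q k) = (\<Sum>q=1..N. D q * R q k) + T * (\<Sum>q=1..N. v q * R q k)"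
        unfolding sum_distrib_left sum.distrib[symmetric]
        by (intro sum.cong) (auto simp: D_def algebra_simps)
      then show ?thesis using stat[OF that] by simp
    qed
    have "(\<Sum>q=1..N. X q * chi_square N v (\<lambda>k. X k + R q k - (T + 1) * v k))
        = (\<Sum>q=1..N. X q * (chi_square N v D + 2 * (\<Sum>k=1..N. D k * (R q k - v k) / v k) + V q))"
      unfolding chi_square_def V_def sum_distrib_left sum.distrib[symmetric] D_def
      by (intro sum.cong refl) (auto simp: power2_eq_square algebra_simps add_divide_distrib diff_divide_distrib)
    also have "\<dots> = T * chi_square N v D + 2 * (\<Sum>q=1..N. \<Sum>k=1..N. X q * (D k * (R q k - v k) / v k))
                    + (\<Sum>q=1..N. X q * V q)"
      by (simp add: XT[symmetric] distrib_left sum.distrib sum_distrib_left sum_distrib_right mult_ac)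
    also have "(\<Sum>q=1..N. \<Sum>k=1..N. X q * (D k * (R q k - v k) / v k))
        = (\<Sum>k=1..N. ((\<Sum>q=1..N. X q * R q k) - (\<Sum>q=1..N. X q) * v k) * D k / v k)"
    proof (subst sum.swap, intro sum.cong refl)
      fix k
      have eq: "(\<Sum>q=1..N. X q * R q k) - (\<Sum>q=1..N. X q) * v k = (\<Sum>q=1..N. X q * (R q k - v k))"
        by (simp add: sum_subtractf sum_distrib_right right_diff_distrib)
      show "(\<Sum>q=1..N. X q * (D k * (R q k - v k) / v k))
          = ((\<Sum>q=1..N. X q * R q k) - (\<Sum>q=1..N. X q) * v k) * D k / v k"
        unfolding eq unfolding sum_distrib_right sum_divide_distrib by (simp add: mult_ac)
    qed
    also have "\<dots> = (\<Sum>k=1..N. (\<Sum>q=1..N. D q * R q k) * D k / v k)"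
      using XR XT by (intro sum.cong) auto
    also have "(\<Sum>q=1..N. X q * V q) \<le> (\<Sum>q=1..N. X q * C)"
      using X0 VC by (intro sum_mono mult_left_mono) auto
    also have "\<dots> = T * C" unfolding XT[symmetric] by (simp only: sum_distrib_right)
    finally have "(\<Sum>q=1..N. X q * chi_square N v (\<lambda>k. X k + R q k - (T + 1) * v k))
       \<le> T * chi_square N v D + 2 * (\<Sum>k=1..N. (\<Sum>q=1..N. D q * R q k) * D k / v k) + T * C"
      by simp
    also have "\<dots> \<le> T * chi_square N v D + 2 * ((1 - c) * chi_square N v D) + T * C"
      using c(3)[OF D0] by simp
    finally show "(\<Sum>q=1..N. X q * chi_square N v (\<lambda>k. X k + R q k - (T + 1) * v k))
       \<le> (T + 2 * (1 - c)) * chi_square N v (\<lambda>k. X k - T * v k) + T * C"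
      by (simp add: D_def[abs_def] algebra_simps)
  qed
qed

end

section \<open>Summability and convergence of real sequences\<close>

text \<open>Dividing by \<open>(n+1)^2\<close> balances a growth factor \<open>1 + 2 / (n+1)\<close>
  to first order. The deficit \<open>c\<close> then leaves a loss \<open>c a(n) / (n+1)^3\<close> in
  every step, and the losses are summable because \<open>b\<close> telescopes and the errors
  \<open>C / (n+2)^2\<close> are summable.\<close>

lemma summable_of_drift:
  fixes a :: "nat \<Rightarrow> real"
  assumes a0: "\<And>n. 0 \<le> a n" and c: "0 < c" "c \<le> 1/3" and C: "0 \<le> C"
    and rec: "\<And>n. n \<ge> 1 \<Longrightarrow> a (Suc n) \<le> (1 + 2 * (1 - c) / (real n + 1)) * a n + C"
  shows "summable (\<lambda>n. a n / (real n + 1) ^ 3)"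
proof -
  define b where "b n = a n / (real n + 1) ^ 2" for n
  have sq: "summable (\<lambda>n. 1 / (real n + 2)\<^sup>2)"
  proof -
    have "summable (\<lambda>n. inverse (real n ^ 2))"
      by (rule inverse_power_summable) simp
    then have "summable (\<lambda>n. inverse (real (n + 2) ^ 2))"
      by (subst summable_iff_shift)
    then show ?thesis by (simp add: inverse_eq_divide add.commute)
  qed
  have sq1: "summable (\<lambda>n. 1 / (real (Suc n) + 2)\<^sup>2)"
    using sq by (subst summable_Suc_iff)
  have step: "c * (a n / (real n + 1) ^ 3) \<le> b n - b (Suc n) + C * (1 / (real n + 2)\<^sup>2)" if "n \<ge> 1" for n
  proof -
    define t where "t = real n + 1"
    have t: "t \<ge> 2" using that by (simp add: t_def)
    \<comment> \<open>Equivalent to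
      \<open>(1 + 2 (1 - c) / t) / (t + 1)^2 <= 1 / t^2 - c / t^3\<close>. The two sides of the
      polynomial form differ by \<open>t - c + c t (t - 2)\<close>, where \<open>t >= 2\<close>,
      that is \<open>n >= 1\<close>, enters.\<close>
    have ineq: "(1 + 2 * (1 - c) / t) * t^3 \<le> (t - c) * (t + 1)\<^sup>2"
    proof -
      have "(1 + 2 * (1 - c) / t) * t^3 = t^3 + 2 * (1 - c) * t\<^sup>2"
        using t by (simp add: field_simps power2_eq_square power3_eq_cube)
      moreover have "(t - c) * (t + 1)\<^sup>2 - (t^3 + 2 * (1 - c) * t\<^sup>2) = t - c + c * (t * (t - 2))"
        by (simp add: power2_eq_square power3_eq_cube algebra_simps)
      moreover have "c * (t * (t - 2)) \<ge> 0" using c t by simp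
      ultimately show ?thesis using c t by linarith
    qed
    have "b (Suc n) \<le> ((1 + 2 * (1 - c) / t) * a n + C) / (t + 1)\<^sup>2"
      using rec[OF that] unfolding b_def t_def
      by (auto simp: add_ac intro!: divide_right_mono)
    also have "\<dots> = (1 + 2 * (1 - c) / t) / (t + 1)\<^sup>2 * a n + C * (1 / (t + 1)\<^sup>2)"
      by (simp only: add_divide_distrib[of _ C]) simp
    also have "(1 + 2 * (1 - c) / t) / (t + 1)\<^sup>2 \<le> (t - c) / t ^ 3"
      using ineq t by (simp add: divide_simps mult_ac)
    then have "(1 + 2 * (1 - c) / t) / (t + 1)\<^sup>2 * a n \<le> (t - c) / t ^ 3 * a n"
      using a0 by (rule mult_right_mono)
    also have "(t - c) / t ^ 3 * a n = b n - c * (a n / t ^ 3)"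
      using t by (simp add: b_def flip: t_def) (simp add: field_simps power2_eq_square power3_eq_cube)
    finally show ?thesis by (simp add: t_def add_ac)
  qed
  have "summable (\<lambda>n. c * (a (Suc n) / (real (Suc n) + 1) ^ 3))"
  proof (rule summableI_nonneg_bounded)
    fix n
    have "(\<Sum>i<n. c * (a (Suc i) / (real (Suc i) + 1) ^ 3))
        \<le> (\<Sum>i<n. b (Suc i) - b (Suc (Suc i)) + C * (1 / (real (Suc i) + 2)\<^sup>2))"
      by (intro sum_mono step) auto
    also have "\<dots> = b 1 - b (Suc n) + C * (\<Sum>i<n. 1 / (real (Suc i) + 2)\<^sup>2)"
      by (simp add: sum.distrib sum_distrib_left sum_lessThan_telescope'[of "\<lambda>i. b (Suc i)"])
    also have "\<dots> \<le> b 1 + C * (\<Sum>i. 1 / (real (Suc i) + 2)\<^sup>2)"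
    proof -
      have "(\<Sum>i<n. 1 / (real (Suc i) + 2)\<^sup>2) \<le> (\<Sum>i. 1 / (real (Suc i) + 2)\<^sup>2)"
        by (intro sum_le_suminf sq1) auto
      then have "C * (\<Sum>i<n. 1 / (real (Suc i) + 2)\<^sup>2) \<le> C * (\<Sum>i. 1 / (real (Suc i) + 2)\<^sup>2)"
        using C by (rule mult_left_mono)
      moreover have "b (Suc n) \<ge> 0" using a0 by (simp add: b_def)
      ultimately show ?thesis by linarith
    qed
    finally show "(\<Sum>i<n. c * (a (Suc i) / (real (Suc i) + 1) ^ 3))
       \<le> b 1 + C * (\<Sum>i. 1 / (real (Suc i) + 2)\<^sup>2)" .
  qed (use a0 c in auto)
  then have "summable (\<lambda>n. a (Suc n) / (real (Suc n) + 1) ^ 3)"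
    using c by (subst (asm) summable_cmult_iff) auto
  then show ?thesis by (subst (asm) summable_Suc_iff)
qed

text \<open>\<open>x^3 - y^3\<close> factors into \<open>x - y\<close>, of order
  \<open>1 / n\<close>, and a term of order \<open>x^2 + y^2\<close>, so by \<open>sm\<close> the
  cubes have summable increments. The continuous real cube root then gives a limit of
  \<open>u\<close> itself, sign included, and a nonzero limit would make the harmonic series
  converge.\<close>

lemma tendsto_zero_of_slow_variation:
  fixes u :: "nat \<Rightarrow> real"
  assumes incr: "\<And>n. n \<ge> 1 \<Longrightarrow> \<bar>u (Suc n) - u n\<bar> \<le> B / (real n + 1)"
    and sm: "summable (\<lambda>n. (u n)\<^sup>2 / (real n + 1))"
  shows "u \<longlonglongrightarrow> 0"
proof -
  have B: "B \<ge> 0" using order_trans[OF abs_ge_zero incr[of 1]] by simp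
  have sm1: "summable (\<lambda>n. (u (Suc n))\<^sup>2 / (real (Suc n) + 1))"
    using sm by (subst summable_Suc_iff)
  have "summable (\<lambda>n. u (Suc n) ^ 3 - u n ^ 3)"
  proof (rule summable_comparison_test')
    show "summable (\<lambda>n. B * (3 * ((u (Suc n))\<^sup>2 / (real (Suc n) + 1)) + 3 / 2 * ((u n)\<^sup>2 / (real n + 1))))"
      using sm sm1 by (intro summable_mult summable_add)
  next
    fix n :: nat assume n: "n \<ge> 1"
    define x y where "x = u (Suc n)" and "y = u n"
    have "x ^ 3 - y ^ 3 = (x - y) * (x\<^sup>2 + x * y + y\<^sup>2)"
      by (simp add: power2_eq_square power3_eq_cube algebra_simps)
    then have "norm (x ^ 3 - y ^ 3) = \<bar>x - y\<bar> * \<bar>x\<^sup>2 + x * y + y\<^sup>2\<bar>"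
      by (simp add: abs_mult)
    also have "\<bar>x\<^sup>2 + x * y + y\<^sup>2\<bar> \<le> 3 / 2 * (x\<^sup>2 + y\<^sup>2)"
    proof -
      have "(x - y)\<^sup>2 \<ge> 0" "(x + y)\<^sup>2 \<ge> 0" by auto
      then show ?thesis by (auto simp: power2_eq_square algebra_simps abs_le_iff)
    qed
    also have "\<bar>x - y\<bar> * (3 / 2 * (x\<^sup>2 + y\<^sup>2)) \<le> B / (real n + 1) * (3 / 2 * (x\<^sup>2 + y\<^sup>2))"
      using incr[OF n] by (intro mult_right_mono) (auto simp: x_def y_def)
    also have "\<dots> = B * (3 / 2 * (x\<^sup>2 / (real n + 1)) + 3 / 2 * (y\<^sup>2 / (real n + 1)))"
      by (simp add: add_divide_distrib distrib_left mult.commute)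
    \<comment> \<open>The square of the later term needs its own denominator \<open>n + 2\<close>;
      since \<open>n + 2 <= 2 (n + 1)\<close>, this costs a factor 2.\<close>
    also have "\<dots> \<le> B * (3 * (x\<^sup>2 / (real (Suc n) + 1)) + 3 / 2 * (y\<^sup>2 / (real n + 1)))"
    proof (intro mult_left_mono add_right_mono B)
      have "x\<^sup>2 / (real n + 1) \<le> x\<^sup>2 / ((real (Suc n) + 1) / 2)"
        using n by (intro divide_left_mono) auto
      also have "x\<^sup>2 / ((real (Suc n) + 1) / 2) = 2 * (x\<^sup>2 / (real (Suc n) + 1))" by simp
      finally show "3 / 2 * (x\<^sup>2 / (real n + 1)) \<le> 3 * (x\<^sup>2 / (real (Suc n) + 1))" by linarith
    qed
    finally show "norm (u (Suc n) ^ 3 - u n ^ 3)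
       \<le> B * (3 * ((u (Suc n))\<^sup>2 / (real (Suc n) + 1)) + 3 / 2 * ((u n)\<^sup>2 / (real n + 1)))"
      by (auto simp: x_def y_def mult_left_mono)
  qed
  then have "convergent (\<lambda>n. u n ^ 3)" 
    by (simp add: summable_iff_convergent sum_lessThan_telescope[of "\<lambda>n. u n ^ 3"] convergent_diff_const_right_iff)
  then obtain L where L: "(\<lambda>n. u n ^ 3) \<longlonglongrightarrow> L" by (auto simp: convergent_def)
  have "(\<lambda>n. root 3 (u n ^ 3)) \<longlonglongrightarrow> root 3 L"
    using L by (intro tendsto_intros)
  then have u: "u \<longlonglongrightarrow> root 3 L" by (simp add: odd_real_root_power_cancel)
  have "L = 0"
  proof (rule ccontr)
    assume L0: "L \<noteq> 0"
    define r where "r = (root 3 L)\<^sup>2 / 2"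
    have r: "0 < r" "r < (root 3 L)\<^sup>2" using L0 by (auto simp: r_def)
    have "eventually (\<lambda>n. r < (u n)\<^sup>2) sequentially"
      using u r by (intro order_tendstoD) (auto intro!: tendsto_intros)
    then have "summable (\<lambda>n. r * (1 / (real n + 1)))"
      by (intro summable_comparison_test_ev[OF _ sm])
         (auto elim!: eventually_mono simp: r less_imp_le divide_right_mono)
    then have "summable (\<lambda>n. 1 / (real n + 1))"
      using r by (subst (asm) summable_cmult_iff) auto
    then have "summable (\<lambda>n. inverse (real (Suc n)))"
      by (simp add: inverse_eq_divide add.commute)
    then have "summable (\<lambda>n. inverse (real n))"
      by (subst (asm) summable_Suc_iff)
    then show False using not_summable_harmonic[where ?'a=real] by simp
  qed
  with u show ?thesis by simp
qed

section \<open>The replacement matrix of the search tree\<close>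

definition gap_type :: "nat \<Rightarrow> nat \<Rightarrow> nat" where
  "gap_type m p = (if p < m - 1 then m + p else 2 * m - 1 - p)"

text \<open>The two formulas agree at level \<open>m - 1\<close>. At level \<open>2 m - 1\<close>, a
  full node without empty subtrees, the value is 0 for \<open>m \<ge> 2\<close>.\<close>

definition gap_size :: "nat \<Rightarrow> nat \<Rightarrow> nat" where
  "gap_size m p = (if p \<le> m - 1 then p + 1 else 2 * m - 1 - p)"

text \<open>A hit moves the node from level \<open>p\<close> to the next one: its old gaps disappear
  and those of the next level appear. A full node also acquires a new child with one key, whose two
  gaps are at level 1.\<close>

definition replacement :: "nat \<Rightarrow> nat \<Rightarrow> nat \<Rightarrow> real" where
  "replacement m p q = (if q = Suc p then real (gap_size m q) else 0) - (if q = p then real (gap_size m p) else 0)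
     + (if m - 1 \<le> p \<and> q = 1 then 2 else 0)"

lemma harmonic_eq: "m \<ge> 2 \<Longrightarrow> (\<Sum>p=1..m-2. 1 / (real p + 2)) = harmonic m - 3/2"
proof (induction m rule: dec_induct)
  case base
  show ?case by (simp add: harmonic_def numeral_2_eq_2)
next
  case (step m)
  then have "Suc m - 2 = Suc (m - 2)" by simp
  with step show ?case by (simp add: harmonic_def add_ac of_nat_diff)
qed

lemma harmonic_gt_1: "m \<ge> 2 \<Longrightarrow> harmonic m > 1"
proof -
  assume "m \<ge> 2"
  then have "harmonic m - 3/2 \<ge> 0"
    unfolding harmonic_eq[symmetric, OF \<open>m \<ge> 2\<close>] by (intro sum_nonneg) auto
  then show ?thesis by linarith
qed

lemma sum_full_levels:
  "m \<ge> 1 \<Longrightarrow> (\<Sum>p=m-1..2*m-2. real (2 * m - 1 - p)) = real m * (real m + 1) / 2"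
proof -
  assume "m \<ge> 1"
  then have "(\<Sum>p=m-1..2*m-2. real (2 * m - 1 - p)) = (\<Sum>i=1..m. real i)"
    by (intro sum.reindex_bij_witness[of _ "\<lambda>i. 2 * m - 1 - i" "\<lambda>p. 2 * m - 1 - p"]) auto
  also have "\<dots> = real m * (real m + 1) / 2"
    using double_gauss_sum_from_Suc_0[of m, where ?'a=real] by simp
  finally show ?thesis .
qed

text \<open>Level \<open>m - 1\<close> is type \<open>m\<close>, a full node with all subtrees
  empty. There \<open>m\<close> cancels in \<open>limvec\<close>, so the formula of the smaller
  levels extends to it.\<close>

lemma limvec_gap_type_leaf:
  "1 \<le> p \<Longrightarrow> p \<le> m - 1 \<Longrightarrow> m \<ge> 2 \<Longrightarrow> limvec m (gap_type m p) = 1 / ((real p + 2) * (harmonic m - 1))"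
proof (cases "p < m - 1")
  case False
  assume "1 \<le> p" "p \<le> m - 1" "m \<ge> 2"
  with False have "gap_type m p = m" "real p + 2 = real m + 1" by (auto simp: gap_type_def of_nat_diff)
  then show ?thesis using \<open>m \<ge> 2\<close> by (simp add: limvec_def)
qed (auto simp: limvec_def gap_type_def)

lemma limvec_gap_type_full:
  "m - 1 \<le> p \<Longrightarrow> limvec m (gap_type m p) = real (2 * m - 1 - p) / (real m * (real m + 1) * (harmonic m - 1))"
  by (auto simp: limvec_def gap_type_def)

text \<open>The full levels carry half of the flow \<open>1 / (harmonic m - 1)\<close> into level 1,
  because a hit on a full node opens two gaps there. The other levels add up to a shifted harmonic
  sum, which completes the mass to 1.\<close>

lemma limvec_sum:
  assumes "m \<ge> 2"
  shows "(\<Sum>p=m-1..2*m-2. limvec m (gap_type m p)) = 1 / (2 * (harmonic m - 1))"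
    and "(\<Sum>p=1..2*m-2. limvec m (gap_type m p)) = 1"
proof -
  have H: "harmonic m - 1 > 0" using harmonic_gt_1[OF assms] by simp
  have "(\<Sum>p=m-1..2*m-2. limvec m (gap_type m p))
     = (\<Sum>p=m-1..2*m-2. real (2 * m - 1 - p)) / (real m * (real m + 1) * (harmonic m - 1))"
    unfolding sum_divide_distrib by (intro sum.cong) (auto simp: limvec_gap_type_full)
  also have "(\<Sum>p=m-1..2*m-2. real (2 * m - 1 - p)) = real m * (real m + 1) / 2"
    using assms by (intro sum_full_levels) simp
  also have "real m * (real m + 1) / 2 / (real m * (real m + 1) * (harmonic m - 1)) = 1 / (2 * (harmonic m - 1))"
  proof -
    have "A / 2 / (A * h) = 1 / (2 * h)" if "A > 0" for A h :: real
      using that by simp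
    then show ?thesis using assms by (auto intro!: mult_pos_pos)
  qed
  finally show 1: "(\<Sum>p=m-1..2*m-2. limvec m (gap_type m p)) = 1 / (2 * (harmonic m - 1))" .
  have "(\<Sum>p=1..m-2. limvec m (gap_type m p)) = (\<Sum>p=1..m-2. 1 / (real p + 2)) / (harmonic m - 1)"
    unfolding sum_divide_distrib using assms by (intro sum.cong) (auto simp: limvec_gap_type_leaf)
  then have 2: "(\<Sum>p=1..m-2. limvec m (gap_type m p)) = (harmonic m - 3/2) / (harmonic m - 1)"
    using harmonic_eq[OF assms] by simp
  have "{1..2*m-2} = {1..m-2} \<union> {m-1..2*m-2}" using assms by auto
  then have "(\<Sum>p=1..2*m-2. limvec m (gap_type m p))
      = (\<Sum>p=1..m-2. limvec m (gap_type m p)) + (\<Sum>p=m-1..2*m-2. limvec m (gap_type m p))"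
    by (simp only:) (intro sum.union_disjoint, auto)
  then show "(\<Sum>p=1..2*m-2. limvec m (gap_type m p)) = 1"
    unfolding 1 2 using H by (simp add: field_simps)
qed

lemma limvec_pos: "m \<ge> 2 \<Longrightarrow> p \<in> {1..2*m-2} \<Longrightarrow> 0 < limvec m (gap_type m p)"
  using harmonic_gt_1[of m] limvec_gap_type_leaf[of p m] limvec_gap_type_full[of m p]
  by (cases "p \<le> m - 1") auto

text \<open>Every insertion adds exactly one gap: a node below capacity gains one, while a full node
  loses one and its new child opens two. At level \<open>2 m - 2\<close> the successor is out of
  range but would have size 0.\<close>

lemma replacement_row_sum:
  assumes "m \<ge> 2" "p \<in> {1..2*m-2}"
  shows "(\<Sum>q=1..2*m-2. replacement m p q) = 1"
proof -
  have "(\<Sum>q=1..2*m-2. replacement m p q)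
      = (if Suc p \<in> {1..2*m-2} then real (gap_size m (Suc p)) else 0) - real (gap_size m p) + (if m - 1 \<le> p then 2 else 0)"
  proof -
    have "(\<Sum>q=1..2*m-2. if m - 1 \<le> p \<and> q = 1 then 2 else 0) = (if m - 1 \<le> p then 2 else (0::real))"
      using assms by (cases "m - 1 \<le> p") auto
    then show ?thesis using assms by (simp add: replacement_def sum.distrib sum_subtractf)
  qed
  then show ?thesis using assms by (auto simp: gap_size_def of_nat_diff)
qed

text \<open>Balance of flow through level \<open>q\<close>. For \<open>q <= m - 1\<close> the inflow
  is \<open>1 / (harmonic m - 1)\<close> whatever \<open>q\<close> is; at \<open>q = 1\<close> it
  comes from the new children of full nodes. On the full levels \<open>v\<close> is proportional to
  the size \<open>s = 2 m - 1 - q\<close>, and \<open>(s + 1) s - s s = s\<close>.\<close>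

lemma limvec_replacement:
  assumes "m \<ge> 2" "q \<in> {1..2*m-2}"
  shows "(\<Sum>p=1..2*m-2. limvec m (gap_type m p) * replacement m p q) = limvec m (gap_type m q)"
proof -
  let ?v = "\<lambda>p. limvec m (gap_type m p)"
  have H: "harmonic m - 1 > 0" using harmonic_gt_1[OF assms(1)] by simp
  have Suc_q: "(q = Suc p) = (p = q - 1)" for p using assms by auto
  have "(\<Sum>p=1..2*m-2. ?v p * replacement m p q)
      = (\<Sum>p=1..2*m-2. (if p = q - 1 then ?v p * real (gap_size m q) else 0))
        - (\<Sum>p=1..2*m-2. (if p = q then ?v p * real (gap_size m p) else 0))
        + (\<Sum>p=1..2*m-2. (if m - 1 \<le> p then if q = 1 then 2 * ?v p else 0 else 0))"
    unfolding sum.distrib[symmetric] sum_subtractf[symmetric]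
    using assms by (intro sum.cong) (auto simp: replacement_def Suc_q algebra_simps)
  also have "(\<Sum>p=1..2*m-2. (if m - 1 \<le> p then if q = 1 then 2 * ?v p else 0 else 0))
      = (\<Sum>p=m-1..2*m-2. if q = 1 then 2 * ?v p else 0)"
    using assms by (intro sum.mono_neutral_cong_right) auto
  also have "\<dots> = (if q = 1 then 1 / (harmonic m - 1) else 0)"
  proof (cases "q = 1")
    case True
    then have "(\<Sum>p=m-1..2*m-2. if q = 1 then 2 * ?v p else 0) = 2 * (\<Sum>p=m-1..2*m-2. ?v p)"
      by (simp only: sum_distrib_left simp_thms if_True)
    then show ?thesis unfolding limvec_sum(1)[OF assms(1)] using H True by (simp add: field_simps)
  qed simp
  finally have *: "(\<Sum>p=1..2*m-2. ?v p * replacement m p q)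
     = (if q = 1 then 1 / (harmonic m - 1) else ?v (q - 1) * real (gap_size m q)) - ?v q * real (gap_size m q)"
    using assms by auto
  show ?thesis
  proof (cases "q \<le> m - 1")
    case True
    then have v: "?v q = 1 / ((real q + 2) * (harmonic m - 1))" "gap_size m q = q + 1"
      using assms by (auto simp: limvec_gap_type_leaf gap_size_def)
    have "q \<noteq> 1 \<Longrightarrow> ?v (q - 1) = 1 / ((real q + 1) * (harmonic m - 1))"
      using assms True limvec_gap_type_leaf[of "q - 1" m] by (auto simp: of_nat_diff)
    then have "(if q = 1 then 1 / (harmonic m - 1) else ?v (q - 1) * real (gap_size m q)) = 1 / (harmonic m - 1)"
      using v by (simp add: add.commute)
    moreover have "1 / h - 1 / ((real q + 2) * h) * (real q + 1) = 1 / ((real q + 2) * h)" if "h > 0" for h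
    proof -
      have "real q + 2 > 0" by simp
      then show ?thesis using that by (simp add: divide_simps)
    qed
    ultimately show ?thesis unfolding * v using H by (simp add: add.commute)
  next
    case False
    then have q: "q \<ge> m" using assms by auto
    define d where "d = real m * (real m + 1) * (harmonic m - 1)"
    have d: "d > 0" using H assms by (simp add: d_def)
    have v: "?v q = real (2 * m - 1 - q) / d" "gap_size m q = 2 * m - 1 - q"
      using q assms by (auto simp: limvec_gap_type_full gap_size_def d_def)
    have "?v (q - 1) = (real (2 * m - 1 - q) + 1) / d"
      using q assms limvec_gap_type_full[of m "q - 1"] by (auto simp: d_def of_nat_diff)
    then show ?thesis using * v d q assms by (auto simp: algebra_simps add_divide_distrib)
  qed
qed

lemma urn_chain_search_tree:
  assumes "m \<ge> 2"
  shows "urn_chain (2 * m - 2) (\<lambda>p. limvec m (gap_type m p)) (replacement m)"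
proof
  show "0 < replacement m p (Suc p)" if "p \<in> {1..<2*m-2}" for p
    using that assms by (auto simp: replacement_def gap_size_def)
  show "0 \<le> replacement m p q" if "p \<noteq> q" for p q
    using that by (auto simp: replacement_def)
qed (use assms limvec_pos limvec_sum replacement_row_sum limvec_replacement in auto)

lemma abs_replacement_le: "\<bar>replacement m p q\<bar> \<le> 2 * real m + 4"
proof -
  have g: "real (gap_size m r) \<le> real m + 1" for r by (auto simp: gap_size_def)
  show ?thesis using g[of p] g[of q] by (auto simp: replacement_def abs_if)
qed

section \<open>Insertion into a search tree\<close>

fun keys :: "mtree \<Rightarrow> real set" where
  "keys Leaf = {}"
| "keys (Node ks cs) = set ks \<union> (\<Union>c\<in>set cs. keys c)"

text \<open>The bounds \<open>a\<close> and \<open>b\<close> are the sentinels x_0 and x_m: padding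
  the keys with them places child \<open>j\<close> between entry \<open>j\<close> of
  \<open>a # ks\<close> and entry \<open>j\<close> of \<open>ks @ [b]\<close>.\<close>

inductive search_tree :: "nat \<Rightarrow> real \<Rightarrow> real \<Rightarrow> mtree \<Rightarrow> bool" for m where
  Leaf: "search_tree m a b Leaf"
| Node: "sorted_wrt (<) ks \<Longrightarrow> set ks \<subseteq> {a<..<b} \<Longrightarrow> 1 \<le> length ks \<Longrightarrow> length ks \<le> m - 1 \<Longrightarrow>
    length cs = m \<Longrightarrow> (length ks < m - 1 \<Longrightarrow> cs = replicate m Leaf) \<Longrightarrow>
    (\<And>j. length ks = m - 1 \<Longrightarrow> j < m \<Longrightarrow> search_tree m ((a # ks) ! j) ((ks @ [b]) ! j) (cs ! j)) \<Longrightarrow>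
    search_tree m a b (Node ks cs)"

definition empties :: "mtree list \<Rightarrow> nat" where
  "empties cs = length (filter (\<lambda>c. c = Leaf) cs)"

text \<open>A full node without empty subtrees gets level \<open>2 m - 1\<close>, just beyond the
  levels that own gaps.\<close>

fun level :: "nat \<Rightarrow> mtree \<Rightarrow> nat" where
  "level m Leaf = 0"
| "level m (Node ks cs) = (if length ks < m - 1 then length ks else 2 * m - 1 - empties cs)"

text \<open>The level of the node owning the gap into which the key falls, found along the search
  path of \<open>ins\<close>. In a search tree a node below capacity ends the descent, since its
  children are all \<open>Leaf\<close>.\<close>

function hit :: "nat \<Rightarrow> real \<Rightarrow> mtree \<Rightarrow> nat" where
  "hit m x Leaf = 0"
| "hit m x (Node ks cs) =
     (let j = length (filter (\<lambda>k. k < x) ks)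
      in if j < length cs \<and> cs ! j \<noteq> Leaf then hit m x (cs ! j) else level m (Node ks cs))"
  by pat_completeness auto
termination
  by (relation "Wellfounded.measure (\<lambda>(m, x, t). size t)") (auto intro: mtree_size_child_aux)

lemma map_zip_upt_eq_update:
  "map (\<lambda>(i, c). if i = j then f c else c) (zip [0..<length cs] cs)
   = (if j < length cs then cs[j := f (cs ! j)] else cs)"
  by (auto intro!: nth_equalityI simp: nth_list_update)

lemma ins_Node_full:
  assumes "\<not> length ks < m - 1" "j = length (filter (\<lambda>k. k < x) ks)" "j < length cs"
  shows "ins m x (Node ks cs) = Node ks (cs[j := ins m x (cs ! j)])"
  using assms map_zip_upt_eq_update[of j "ins m x" cs] by (simp add: Let_def)

lemma ins_not_Leaf [simp]: "ins m x t \<noteq> Leaf"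
  by (cases t) (auto simp: Let_def)

lemma slot:
  fixes x :: real
  assumes "sorted_wrt (<) ks" "set ks \<subseteq> {a<..<b}" "a < x" "x < b" "x \<notin> set ks"
    "j = length (filter (\<lambda>k. k < x) ks)"
  shows "j \<le> length ks \<and> (a # ks) ! j < x \<and> x < (ks @ [b]) ! j"
  using assms
proof (induction ks arbitrary: a j)
  case (Cons k ks)
  show ?case
  proof (cases "k < x")
    case True
    have "set ks \<subseteq> {k<..<b}" using Cons.prems by auto
    then show ?thesis using True Cons.prems Cons.IH[of k "j - 1"] by auto
  next
    case False
    then have "filter (\<lambda>k. k < x) ks = []" using Cons.prems by (auto simp: filter_empty_conv)
    then show ?thesis using False Cons.prems by auto
  qed
qed auto

text \<open>Gaps are labelled by left endpoints, and a separating key labels the gap to its right;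
  hence the half-open interval. Uniqueness of the index makes the label sets of different children
  disjoint.\<close>

lemma slot_le_unique:
  fixes y :: real
  assumes "sorted_wrt (<) ks" "set ks \<subseteq> {a<..<b}" "j \<le> length ks"
    "(a # ks) ! j \<le> y" "y < (ks @ [b]) ! j"
  shows "length (filter (\<lambda>k. k \<le> y) ks) = j"
  using assms
proof (induction ks arbitrary: a j)
  case (Cons k ks)
  show ?case
  proof (cases j)
    case 0
    then have "filter (\<lambda>k. k \<le> y) ks = []" using Cons.prems by (auto simp: filter_empty_conv)
    then show ?thesis using 0 Cons.prems by auto
  next
    case (Suc i)
    have "k \<le> (k # ks) ! i" using Cons.prems Suc by (cases i) (auto intro!: less_imp_le)
    moreover have "set ks \<subseteq> {k<..<b}" using Cons.prems by auto
    ultimately show ?thesis using Suc Cons.prems Cons.IH[of k i] by auto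
  qed
qed auto

lemma slot_nonempty:
  fixes a b :: real
  assumes "sorted_wrt (<) ks" "set ks \<subseteq> {a<..<b}" "a < b" "j \<le> length ks"
  shows "(a # ks) ! j < (ks @ [b]) ! j" "a \<le> (a # ks) ! j" "(ks @ [b]) ! j \<le> b"
proof -
  show "(a # ks) ! j < (ks @ [b]) ! j"
    using assms
  proof (induction ks arbitrary: a j)
    case (Cons k ks)
    have "set ks \<subseteq> {k<..<b}" using Cons.prems by auto
    then show ?case using Cons.prems Cons.IH[of k "j - 1"] by (cases j) auto
  qed auto
  have "(a # ks) ! j \<in> set (a # ks)" "(ks @ [b]) ! j \<in> set (ks @ [b])"
    using assms(4) by (intro nth_mem; simp)+
  then show "a \<le> (a # ks) ! j" "(ks @ [b]) ! j \<le> b" using assms(2) by auto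
qed

lemma keys_search_tree_subset: "search_tree m a b t \<Longrightarrow> a < b \<Longrightarrow> keys t \<subseteq> {a<..<b}"
proof (induction rule: search_tree.induct)
  case (Node ks a b cs)
  have "keys c \<subseteq> {a<..<b}" if c: "c \<in> set cs" for c
  proof (cases "length ks < m - 1")
    case True
    then show ?thesis using Node c by auto
  next
    case False
    then have L: "length ks = m - 1" using Node by simp
    from c obtain j where j: "j < m" "c = cs ! j" using Node by (auto simp: in_set_conv_nth)
    then have jl: "j \<le> length ks" using L by simp
    note s = slot_nonempty[OF Node.hyps(1,2) \<open>a < b\<close> jl]
    have "keys c \<subseteq> {(a # ks) ! j<..<(ks @ [b]) ! j}"
      using Node.IH[OF L j(1) s(1)] j by simp
    then show ?thesis using s by fastforce
  qed
  then show ?case using Node.hyps(2) by auto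
qed auto

lemma keys_ins_subset: "keys (ins m x t) \<subseteq> insert x (keys t)"
proof (induction m x t rule: ins.induct)
  case (2 m x ks cs)
  show ?case
  proof (cases "length ks < m - 1")
    case True
    then show ?thesis by (auto simp: set_insort_key)
  next
    case False
    define j where "j = length (filter (\<lambda>k. k < x) ks)"
    have "ins m x (Node ks cs) = Node ks (if j < length cs then cs[j := ins m x (cs ! j)] else cs)"
      using False map_zip_upt_eq_update[of j "ins m x" cs] by (simp add: Let_def j_def)
    moreover have "keys (ins m x (cs ! j)) \<subseteq> insert x (keys (cs ! j))" if "j < length cs"
    proof -
      have "(j, cs ! j) \<in> set (zip [0..<length cs] cs)"
        using that by (auto simp: set_zip intro!: exI[of _ j])
      then show ?thesis using 2[OF False j_def, of "(j, cs ! j)" j "cs ! j"] by auto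
    qed
    moreover have "(\<Union>c\<in>set (cs[j := u]). keys c) \<subseteq> (\<Union>c\<in>set cs. keys c) \<union> keys u" for u
      using set_update_subset_insert[of cs j u] by auto
    moreover have "j < length cs \<Longrightarrow> keys (cs ! j) \<subseteq> (\<Union>c\<in>set cs. keys c)"
      by (meson UN_upper nth_mem)
    ultimately show ?thesis by (cases "j < length cs") fastforce+
  qed
qed auto

lemma keys_update:
  assumes "j < length cs" "keys u = insert x (keys (cs ! j))"
  shows "(\<Union>c\<in>set (cs[j := u]). keys c) = insert x (\<Union>c\<in>set cs. keys c)"
proof -
  have *: "(\<Union>c\<in>set xs. keys c) = (\<Union>i<length xs. keys (xs ! i))" for xs
    unfolding set_conv_nth by auto
  show ?thesis
    unfolding * using assms by (auto simp: nth_list_update split: if_splits) 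
qed

lemma sorted_wrt_insort:
  fixes x :: real
  assumes "sorted_wrt (<) ks" "x \<notin> set ks" shows "sorted_wrt (<) (insort x ks)"
  using assms by (simp add: strict_sorted_iff sorted_insort distinct_insort)

lemma search_tree_leaf_node:
  assumes "m \<ge> 2" "sorted_wrt (<) ks" "set ks \<subseteq> {a<..<b}" "1 \<le> length ks" "length ks \<le> m - 1"
  shows "search_tree m a b (Node ks (replicate m Leaf))"
  using assms by (intro search_tree.Node) (auto intro: search_tree.Leaf)

lemma search_tree_ins:
  assumes "m \<ge> 2" "search_tree m a b t" "a < x" "x < b" "x \<notin> keys t"
  shows "search_tree m a b (ins m x t) \<and> keys (ins m x t) = insert x (keys t)"
  using assms(2-)
proof (induction rule: search_tree.induct)
  case (Leaf a b)
  then show ?case using \<open>m \<ge> 2\<close> by (auto intro!: search_tree_leaf_node)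
next
  case (Node ks a b cs)
  show ?case
  proof (cases "length ks < m - 1")
    case True
    then have "search_tree m a b (Node (insort x ks) (replicate m Leaf))"
      using Node \<open>m \<ge> 2\<close> by (intro search_tree_leaf_node sorted_wrt_insort) (auto simp: set_insort_key)
    then show ?thesis using True Node by (auto simp: set_insort_key)
  next
    case False
    then have L: "length ks = m - 1" using Node by simp
    define j where "j = length (filter (\<lambda>k. k < x) ks)"
    have s: "j \<le> length ks" "(a # ks) ! j < x" "x < (ks @ [b]) ! j"
      using slot[of ks a b x j] Node j_def by auto
    have jm: "j < m" using s(1) L \<open>m \<ge> 2\<close> by simp
    have eq: "ins m x (Node ks cs) = Node ks (cs[j := ins m x (cs ! j)])"
      using False j_def jm Node by (intro ins_Node_full) auto
    have "x \<notin> keys (cs ! j)" using Node.prems Node.hyps jm by auto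
    then have IH: "search_tree m ((a # ks) ! j) ((ks @ [b]) ! j) (ins m x (cs ! j))"
      "keys (ins m x (cs ! j)) = insert x (keys (cs ! j))"
      using Node.IH[OF L jm] s by auto
    have "search_tree m a b (Node ks (cs[j := ins m x (cs ! j)]))"
    proof (rule search_tree.Node)
      show "search_tree m ((a # ks) ! i) ((ks @ [b]) ! i) (cs[j := ins m x (cs ! j)] ! i)" if "i < m" for i
        using that IH Node.hyps(5) Node.hyps(7)[OF L that] by (cases "i = j") auto
    qed (use Node False in auto)
    then show ?thesis
      unfolding eq using keys_update[of j cs "ins m x (cs ! j)" x] IH Node.hyps jm by auto
  qed
qed

section \<open>Gap counts under one insertion\<close>

text \<open>Separates the gaps of the root from those of its subtrees. The condition
  \<open>1 \<le> e\<close> in \<open>gaps\<close> corresponds to level \<open>2 m - 1\<close> lying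
  outside the range of \<open>q\<close>.\<close>

lemma gaps_Node_level:
  assumes "m \<ge> 2" "q \<in> {1..2*m-2}" "1 \<le> length ks" "length ks \<le> m - 1" "length cs = m"
  shows "gaps m (gap_type m q) (Node ks cs)
    = (if q = level m (Node ks cs) then gap_size m q else 0) + sum_list (map (gaps m (gap_type m q)) cs)"
proof -
  have e: "empties cs \<le> m" using length_filter_le[of _ cs] assms by (simp add: empties_def)
  show ?thesis
  proof (cases "length ks < m - 1")
    case True
    then have "gap_type m q = m + length ks \<longleftrightarrow> q = length ks"
      using assms by (auto simp: gap_type_def)
    then show ?thesis using True assms(3) by (auto simp: gap_size_def)
  next
    case False
    then have L: "length ks = m - 1" using assms by simp
    have "gap_type m q = empties cs \<and> 1 \<le> empties cs \<longleftrightarrow> q = 2 * m - 1 - empties cs"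
    using assms e by (auto simp: gap_type_def)
    moreover have "q = 2 * m - 1 - empties cs \<Longrightarrow> gap_size m q = empties cs"
      using assms e by (auto simp: gap_size_def)
    ultimately show ?thesis
      unfolding gaps.simps level.simps empties_def[symmetric] Let_def using L by auto
  qed
qed

lemma empties_replicate [simp]: "empties (replicate m Leaf) = m"
  by (simp add: empties_def)

lemma empties_update:
  assumes "j < length cs" "u \<noteq> Leaf"
  shows "empties cs = empties (cs[j := u]) + (if cs ! j = Leaf then 1 else 0)"
  using assms by (induction cs arbitrary: j) (auto simp: empties_def nth_Cons split: nat.splits)

lemma sum_list_map_update:
  fixes g :: "'b \<Rightarrow> nat"
  assumes "j < length cs"
  shows "real (sum_list (map g (cs[j := u]))) = real (sum_list (map g cs)) - real (g (cs ! j)) + real (g u)"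
  using assms by (induction cs arbitrary: j) (auto split: nat.splits)

lemma gaps_new_node:
  assumes "m \<ge> 2" "q \<in> {1..2*m-2}"
  shows "gaps m (gap_type m q) (Node [x] (replicate m Leaf)) = (if q = 1 then 2 else 0)"
  using assms by (subst gaps_Node_level) (auto simp: sum_list_replicate gap_size_def simp del: gaps.simps(2))

text \<open>One insertion is one urn draw. A node below capacity moves up a level; a full node whose
  chosen subtree is empty moves up and creates a one-key child; if that subtree is nonempty, the
  root keeps its level and the change happens inside the subtree.\<close>

lemma gaps_ins:
  assumes "m \<ge> 2" "search_tree m a b t" "t \<noteq> Leaf" "a < x" "x < b" "x \<notin> keys t" and q: "q \<in> {1..2*m-2}"
  shows "real (gaps m (gap_type m q) (ins m x t)) = real (gaps m (gap_type m q) t) + replacement m (hit m x t) q"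
  using assms(2-6)
proof (induction rule: search_tree.induct)
  case (Node ks a b cs)
  note gN = gaps_Node_level[OF \<open>m \<ge> 2\<close> q]
  define j where "j = length (filter (\<lambda>k. k < x) ks)"
  have s: "j \<le> length ks" "(a # ks) ! j < x" "x < (ks @ [b]) ! j"
    using slot[of ks a b x j] Node j_def by auto
  have jm: "j < m" using s(1) Node.hyps \<open>m \<ge> 2\<close> by simp
  show ?case
  proof (cases "length ks < m - 1")
    case True
    then have cs: "cs = replicate m Leaf" using Node by simp
    have h: "hit m x (Node ks cs) = length ks"
      using True jm cs by (simp add: Let_def flip: j_def)
    have "level m (Node (insort x ks) cs) = Suc (length ks)" using True by (simp add: cs)
    then have "real (gaps m (gap_type m q) (ins m x (Node ks cs)))
       = (if q = Suc (length ks) then real (gap_size m q) else 0) + real (sum_list (map (gaps m (gap_type m q)) cs))"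
      using True Node by (simp add: gN del: gaps.simps level.simps)
    moreover have "real (gaps m (gap_type m q) (Node ks cs))
       = (if q = length ks then real (gap_size m q) else 0) + real (sum_list (map (gaps m (gap_type m q)) cs))"
      using True Node by (simp add: gN del: gaps.simps)
    ultimately show ?thesis unfolding h using True by (auto simp: replacement_def)
  next
    case False
    then have L: "length ks = m - 1" using Node by simp
    define u where "u = ins m x (cs ! j)"
    have eq: "ins m x (Node ks cs) = Node ks (cs[j := u])"
      unfolding u_def using False j_def jm Node by (intro ins_Node_full) auto
    have jl: "j < length cs" using jm Node by simp
    have uL: "u \<noteq> Leaf" by (simp add: u_def)
    note e = empties_update[OF jl uL]
    have em: "empties cs \<le> m" using length_filter_le[of _ cs] Node by (simp add: empties_def)
    have g1: "real (gaps m (gap_type m q) (Node ks (cs[j := u])))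
       = (if q = 2 * m - 1 - empties (cs[j := u]) then real (gap_size m q) else 0)
         + real (sum_list (map (gaps m (gap_type m q)) cs)) - real (gaps m (gap_type m q) (cs ! j)) + real (gaps m (gap_type m q) u)"
      using L Node sum_list_map_update[OF jl, of "gaps m (gap_type m q)" u] by (simp add: gN del: gaps.simps)
    have g2: "real (gaps m (gap_type m q) (Node ks cs))
       = (if q = 2 * m - 1 - empties cs then real (gap_size m q) else 0) + real (sum_list (map (gaps m (gap_type m q)) cs))"
      using L Node by (simp add: gN del: gaps.simps)
    show ?thesis
    proof (cases "cs ! j = Leaf")
      case True
      then have h: "hit m x (Node ks cs) = 2 * m - 1 - empties cs"
        using L by (simp add: Let_def flip: j_def)
      have "2 * m - 1 - empties (cs[j := u]) = Suc (2 * m - 1 - empties cs)"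
        using e True em \<open>m \<ge> 2\<close> by auto
      moreover have "gaps m (gap_type m q) u = (if q = 1 then 2 else 0)"
        using True gaps_new_node[OF \<open>m \<ge> 2\<close> q, of x] by (simp add: u_def)
      moreover have "m - 1 \<le> 2 * m - 1 - empties cs" using em by simp
      ultimately show ?thesis unfolding eq g1 g2 h using True by (auto simp: replacement_def)
    next
      case False
      have h: "hit m x (Node ks cs) = hit m x (cs ! j)"
        using False jl by (simp add: Let_def flip: j_def)
      have "x \<notin> keys (cs ! j)" using Node.prems jl by auto
      then have "real (gaps m (gap_type m q) u) = real (gaps m (gap_type m q) (cs ! j)) + replacement m (hit m x (cs ! j)) q"
        unfolding u_def using Node.IH[OF L jm False] s by auto
      then show ?thesis unfolding eq g1 g2 h using e False by simp
    qed
  qed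
qed auto

text \<open>The gaps of a tree are indexed by their left endpoints \<open>y\<close>; \<open>s y\<close> is a new key falling
  right after \<open>y\<close>.\<close>

lemma sum_hit:
  fixes f :: "nat \<Rightarrow> real"
  assumes "m \<ge> 2" "search_tree m a b t" "t \<noteq> Leaf" "a < b"
    and s: "\<And>y k. y \<in> insert a (keys t) \<Longrightarrow> k \<in> keys t \<Longrightarrow> k < s y \<longleftrightarrow> k \<le> y"
  shows "(\<Sum>y\<in>insert a (keys t). f (hit m (s y) t)) = (\<Sum>q=1..2*m-2. real (gaps m (gap_type m q) t) * f q)"
  using assms(2-)
proof (induction rule: search_tree.induct)
  case (Node ks a b cs)
  let ?l = "level m (Node ks cs)"
  have gN: "real (gaps m (gap_type m q) (Node ks cs))
    = (if q = ?l then real (gap_size m q) else 0) + (\<Sum>j<m. real (gaps m (gap_type m q) (cs ! j)))"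
    if "q \<in> {1..2*m-2}" for q
    using gaps_Node_level[OF \<open>m \<ge> 2\<close> that Node.hyps(3,4,5)] Node.hyps(5)
    by (simp add: sum_list_sum_nth atLeast0LessThan del: gaps.simps level.simps)
  have "(\<Sum>q=1..2*m-2. real (gaps m (gap_type m q) (Node ks cs)) * f q)
     = (\<Sum>q=1..2*m-2. (if q = ?l then real (gap_size m q) * f q else 0)
          + (\<Sum>j<m. real (gaps m (gap_type m q) (cs ! j)) * f q))"
    using gN by (intro sum.cong) (auto simp: algebra_simps sum_distrib_left simp del: gaps.simps level.simps)
  also have "\<dots> = (if ?l \<in> {1..2*m-2} then real (gap_size m ?l) * f ?l else 0)
     + (\<Sum>j<m. \<Sum>q=1..2*m-2. real (gaps m (gap_type m q) (cs ! j)) * f q)"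
    by (subst sum.swap) (simp add: sum.distrib del: level.simps)
  finally have RHS: "(\<Sum>q=1..2*m-2. real (gaps m (gap_type m q) (Node ks cs)) * f q)
     = (if ?l \<in> {1..2*m-2} then real (gap_size m ?l) * f ?l else 0)
     + (\<Sum>j<m. \<Sum>q=1..2*m-2. real (gaps m (gap_type m q) (cs ! j)) * f q)" .
  have slots: "length (filter (\<lambda>k. k < s y) ks) = length (filter (\<lambda>k. k \<le> y) ks)"
    if "y \<in> insert a (keys (Node ks cs))" for y
    using Node.prems(3)[OF that] by (intro arg_cong[where f=length] filter_cong) auto
  have fin: "finite (keys c)" for c by (induction c) auto
  show ?case
  proof (cases "length ks < m - 1")
    case True
    then have cs: "cs = replicate m Leaf" using Node by simp
    \<comment> \<open>All \<open>length ks + 1\<close> labels, the keys and \<open>a\<close>, belong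
      to gaps of this leaf.\<close>
    have "a \<notin> set ks" using Node by auto
    moreover have "distinct ks" using Node by (simp add: strict_sorted_iff)
    ultimately have card: "card (insert a (keys (Node ks cs))) = Suc (length ks)"
      by (auto simp: cs distinct_card)
    have "hit m (s y) (Node ks cs) = length ks" for y
      using True by (auto simp: cs Let_def)
    then have "(\<Sum>y\<in>insert a (keys (Node ks cs)). f (hit m (s y) (Node ks cs))) = real (Suc (length ks)) * f (length ks)"
      by (simp only: sum_constant card) 
    moreover have "?l = length ks" "gap_size m (length ks) = Suc (length ks)" "length ks \<in> {1..2*m-2}"
      using True Node by (auto simp: gap_size_def)
    ultimately show ?thesis unfolding RHS by (simp add: cs)
  next
    case False
    then have L: "length ks = m - 1" using Node by simp
    \<comment> \<open>The labels of slot \<open>j\<close>: its left boundary and the keys of child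
      \<open>j\<close>. These sets partition all labels; for an empty child only the boundary
      remains, and it labels a gap of the root.\<close>
    define I where "I j = insert ((a # ks) ! j) (keys (cs ! j))" for j
    have jl: "j \<le> length ks" if "j < m" for j using that L by simp
    note sl = slot_nonempty[OF Node.hyps(1,2) \<open>a < b\<close> jl]
    have kI: "y \<in> I j \<Longrightarrow> (a # ks) ! j \<le> y \<and> y < (ks @ [b]) ! j" if "j < m" for j y
      using keys_search_tree_subset[OF Node.hyps(7)[OF L that] sl(1)[OF that]] sl(1)[OF that] by (auto simp: I_def)
    have uniq: "length (filter (\<lambda>k. k \<le> y) ks) = j" if "j < m" "y \<in> I j" for y j
      using slot_le_unique[OF Node.hyps(1,2) jl[OF that(1)]] kI[OF that] by auto
    have U: "insert a (keys (Node ks cs)) = (\<Union>j<m. I j)"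
    proof -
      have "insert a (set ks) = (\<lambda>j. (a # ks) ! j) ` {..<m}"
        using L \<open>m \<ge> 2\<close> set_conv_nth[of "a # ks"] by (auto simp del: nth_Cons)
      moreover have "set cs = (\<lambda>j. cs ! j) ` {..<m}" using Node.hyps(5) by (auto simp: in_set_conv_nth)
      ultimately show ?thesis by (auto simp: I_def)
    qed
    have "(\<Sum>y\<in>insert a (keys (Node ks cs)). f (hit m (s y) (Node ks cs)))
        = (\<Sum>j<m. \<Sum>y\<in>I j. f (hit m (s y) (Node ks cs)))"
      unfolding U
    proof (intro sum.UNION_disjoint ballI impI)
      fix i j assume "i \<in> {..<m}" "j \<in> {..<m}" "i \<noteq> j"
      then show "I i \<inter> I j = {}" using uniq by blast
    qed (auto simp: I_def fin)
    also have "\<dots> = (\<Sum>j<m. (if cs ! j = Leaf then f ?l else 0)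
        + (\<Sum>q=1..2*m-2. real (gaps m (gap_type m q) (cs ! j)) * f q))"
    proof (intro sum.cong refl)
      fix j assume "j \<in> {..<m}"
      then have j: "j < m" by simp
      have sub: "I j \<subseteq> insert a (keys (Node ks cs))" unfolding U using j by auto
      have h: "hit m (s y) (Node ks cs) = (if cs ! j = Leaf then ?l else hit m (s y) (cs ! j))"
        if "y \<in> I j" for y
      proof -
        have "length (filter (\<lambda>k. k < s y) ks) = j"
          using slots[of y] sub that uniq[OF j that] by auto
        then show ?thesis using j Node.hyps(5) by (simp add: Let_def)
      qed
      show "(\<Sum>y\<in>I j. f (hit m (s y) (Node ks cs))) = (if cs ! j = Leaf then f ?l else 0)
        + (\<Sum>q=1..2*m-2. real (gaps m (gap_type m q) (cs ! j)) * f q)"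
      proof (cases "cs ! j = Leaf")
        case True
        then show ?thesis using h by (simp add: I_def del: level.simps hit.simps)
      next
        case False
        have "(\<Sum>y\<in>I j. f (hit m (s y) (cs ! j))) = (\<Sum>q=1..2*m-2. real (gaps m (gap_type m q) (cs ! j)) * f q)"
          unfolding I_def
        proof (rule Node.IH[OF L j False sl(1)[OF j]])
          fix y k assume "y \<in> insert ((a # ks) ! j) (keys (cs ! j))" "k \<in> keys (cs ! j)"
          then have "y \<in> insert a (keys (Node ks cs))" "k \<in> keys (Node ks cs)"
            using sub j Node.hyps(5) by (auto simp: I_def simp del: nth_Cons)
          then show "k < s y \<longleftrightarrow> k \<le> y" by (rule Node.prems(3))
        qed
        then show ?thesis using h False by (simp del: level.simps hit.simps)
      qed
    qed
    also have "\<dots> = real (empties cs) * f ?l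
        + (\<Sum>j<m. \<Sum>q=1..2*m-2. real (gaps m (gap_type m q) (cs ! j)) * f q)"
    proof -
      have "empties cs = card {j. j < m \<and> cs ! j = Leaf}"
        using Node.hyps(5) by (simp add: empties_def length_filter_conv_card)
      also have "{j. j < m \<and> cs ! j = Leaf} = {..<m} \<inter> {j. cs ! j = Leaf}" by auto
      finally show ?thesis by (simp add: sum.distrib sum.If_cases del: level.simps)
    qed
    \<comment> \<open>Without empty subtrees the level is \<open>2 m - 1\<close>, outside the range,
      and both sides vanish.\<close>
    also have "real (empties cs) * f ?l = (if ?l \<in> {1..2*m-2} then real (gap_size m ?l) * f ?l else 0)"
    proof -
      have "empties cs \<le> m" using length_filter_le[of _ cs] Node by (simp add: empties_def)
      then show ?thesis using L \<open>m \<ge> 2\<close> by (cases "empties cs = 0") (auto simp: gap_size_def)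
    qed
    finally show ?thesis unfolding RHS .
  qed
qed auto

section \<open>Order invariance and uniform insertion\<close>

fun relabel :: "(real \<Rightarrow> real) \<Rightarrow> mtree \<Rightarrow> mtree" where
  "relabel \<phi> Leaf = Leaf"
| "relabel \<phi> (Node ks cs) = Node (map \<phi> ks) (map (relabel \<phi>) cs)"

lemma relabel_eq_Leaf [simp]: "relabel \<phi> t = Leaf \<longleftrightarrow> t = Leaf"
  by (cases t) auto

lemma insort_map_strict_mono:
  fixes \<phi> :: "real \<Rightarrow> real"
  assumes "strict_mono_on (insert x (set ks)) \<phi>"
  shows "insort (\<phi> x) (map \<phi> ks) = map \<phi> (insort x ks)"
  using assms
proof (induction ks)
  case (Cons k ks)
  have "strict_mono_on (insert x (set ks)) \<phi>"
    using Cons.prems by (rule monotone_on_subset) auto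
  moreover have "\<phi> x \<le> \<phi> k \<longleftrightarrow> x \<le> k"
    using strict_mono_on_less_eq[OF Cons.prems, of x k] by auto
  ultimately show ?case using Cons.IH by auto
qed auto

text \<open>Insertion only compares keys, so it commutes with an increasing renaming. Monotonicity
  is asked only on the keys involved, because the renaming in \<open>gapvec_order_iso\<close> is
  controlled only there.\<close>

lemma ins_relabel:
  "strict_mono_on (insert x (keys t)) \<phi> \<Longrightarrow> ins m (\<phi> x) (relabel \<phi> t) = relabel \<phi> (ins m x t)"
proof (induction m x t rule: ins.induct)
  case (2 m x ks cs)
  have mono: "strict_mono_on (insert x (set ks)) \<phi>"
    using 2(2) by (rule monotone_on_subset) auto
  show ?case
  proof (cases "length ks < m - 1")
    case True
    then show ?thesis using insort_map_strict_mono[OF mono] by simp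
  next
    case False
    define j where "j = length (filter (\<lambda>k. k < x) ks)"
    have eq: "ins m z (Node ls ds) = Node ls (if j < length ds then ds[j := ins m z (ds ! j)] else ds)"
      if "length ls = length ks" "length (filter (\<lambda>k. k < z) ls) = j" for z ls ds
      using that False map_zip_upt_eq_update[of j "ins m z" ds] by (simp add: Let_def)
    have "filter (\<lambda>k. k < \<phi> x) (map \<phi> ks) = map \<phi> (filter (\<lambda>k. k < x) ks)"
      unfolding filter_map o_def
      using strict_mono_on_less[OF mono] by (intro arg_cong[where f="map \<phi>"] filter_cong) auto
    then have l: "length (filter (\<lambda>k. k < \<phi> x) (map \<phi> ks)) = j" by (simp add: j_def)
    have "ins m (\<phi> x) (relabel \<phi> (cs ! j)) = relabel \<phi> (ins m x (cs ! j))" if "j < length cs"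
    proof -
      have "(j, cs ! j) \<in> set (zip [0..<length cs] cs)"
        using that by (auto simp: set_zip intro!: exI[of _ j])
      moreover have "strict_mono_on (insert x (keys (cs ! j))) \<phi>"
        using 2(2) that by (rule_tac monotone_on_subset) (auto intro!: bexI[of _ "cs ! j"])
      ultimately show ?thesis using 2(1)[OF False j_def, of "(j, cs ! j)" j "cs ! j"] by auto
    qed
    then show ?thesis
      unfolding relabel.simps eq[OF refl j_def[symmetric]] eq[OF length_map l]
      by (auto simp: map_update)
  qed
qed auto

lemma gaps_relabel: "gaps m i (relabel \<phi> t) = gaps m i t"
proof (induction m i t rule: gaps.induct)
  case (2 m i ks cs)
  have 1: "filter (\<lambda>c. c = Leaf) (map (relabel \<phi>) cs) = map (relabel \<phi>) (filter (\<lambda>c. c = Leaf) cs)"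
    unfolding filter_map o_def by simp
  have 2: "map (gaps m i \<circ> relabel \<phi>) cs = map (gaps m i) cs"
    using 2 by simp
  show ?case by (simp only: relabel.simps gaps.simps map_map length_map 1 2)
qed auto

lemma build_0 [simp]: "build m 0 x = Leaf"
  and build_Suc: "build m (Suc n) x = ins m (x n) (build m n x)"
  by (simp_all add: build_def)

lemma build_cong: "(\<And>i. i < n \<Longrightarrow> x i = y i) \<Longrightarrow> build m n x = build m n y"
  by (induction n) (auto simp: build_Suc)

lemma build_ne_Leaf: "n \<ge> 1 \<Longrightarrow> build m n x \<noteq> Leaf"
  by (cases n) (auto simp: build_Suc)

lemma keys_build_subset: "keys (build m n x) \<subseteq> x ` {..<n}"
proof (induction n)
  case (Suc n)
  then show ?case using keys_ins_subset[of m "x n" "build m n x"] by (auto simp: build_Suc lessThan_Suc)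
qed auto

lemma search_tree_build:
  assumes "m \<ge> 2" "inj_on x {..<n}" "\<And>i. i < n \<Longrightarrow> x i \<in> {a<..<b}"
  shows "search_tree m a b (build m n x) \<and> keys (build m n x) = x ` {..<n}"
  using assms(2,3)
proof (induction n)
  case 0
  then show ?case by (auto intro: search_tree.Leaf)
next
  case (Suc n)
  then have "search_tree m a b (build m n x)" "keys (build m n x) = x ` {..<n}"
    by (auto simp: lessThan_Suc)
  moreover have "x n \<notin> x ` {..<n}" by (auto dest: inj_onD[OF Suc.prems(1)])
  ultimately show ?case
    using search_tree_ins[OF \<open>m \<ge> 2\<close>, of a b "build m n x" "x n"] Suc.prems(2)[of n]
    by (simp add: build_Suc lessThan_Suc)
qed

lemma build_relabel:
  "strict_mono_on (x ` {..<n}) \<phi> \<Longrightarrow> build m n (\<phi> \<circ> x) = relabel \<phi> (build m n x)"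
proof (induction n)
  case (Suc n)
  have "strict_mono_on (x ` {..<n}) \<phi>" "strict_mono_on (insert (x n) (keys (build m n x))) \<phi>"
    using keys_build_subset[of m n x] by (auto intro!: monotone_on_subset[OF Suc.prems])
  then show ?case using Suc.IH by (simp add: build_Suc ins_relabel)
qed auto

definition gapvec :: "nat \<Rightarrow> (nat \<Rightarrow> real) \<Rightarrow> nat \<Rightarrow> nat \<Rightarrow> real" where
  "gapvec m x n p = real (gaps m (gap_type m p) (build m n x))"

text \<open>Renaming the keys of \<open>x\<close> into those of \<open>y\<close> is increasing, and
  gap counts do not see it. Under ties \<open>inv_into\<close> may return another index with the
  same key, but the hypothesis forces the same ties in \<open>y\<close>.\<close>

lemma gapvec_order_iso:
  assumes "\<And>i j. i < n \<Longrightarrow> j < n \<Longrightarrow> x i < x j \<longleftrightarrow> y i < y j"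
  shows "gapvec m x n = gapvec m y n"
proof -
  define \<phi> where "\<phi> v = y (inv_into {..<n} x v)" for v
  have \<phi>: "\<phi> (x i) = y i" if i: "i < n" for i
  proof -
    have "inv_into {..<n} x (x i) < n" "x (inv_into {..<n} x (x i)) = x i"
      using inv_into_into[of "x i" x "{..<n}"] f_inv_into_f[of "x i" x "{..<n}"] i by auto
    then show ?thesis
      unfolding \<phi>_def using assms[of "inv_into {..<n} x (x i)" i] assms[of i "inv_into {..<n} x (x i)"] i
      by fastforce
  qed
  have "strict_mono_on (x ` {..<n}) \<phi>"
    using \<phi> assms by (auto simp: strict_mono_on_def)
  then have "build m n (\<phi> \<circ> x) = relabel \<phi> (build m n x)" by (rule build_relabel)
  moreover have "build m n (\<phi> \<circ> x) = build m n y" using \<phi> by (intro build_cong) auto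
  ultimately show ?thesis by (simp add: gapvec_def fun_eq_iff gaps_relabel)
qed

lemma gapvec_step:
  assumes "m \<ge> 2" "n \<ge> 1" "inj_on x {..n}"
  obtains p where "\<And>q. q \<in> {1..2*m-2} \<Longrightarrow> gapvec m x (Suc n) q = gapvec m x n q + replacement m p q"
proof -
  \<comment> \<open>Any open interval around all \<open>n + 1\<close> keys can serve as bounds of
    the search tree.\<close>
  define a b where "a = Min (x ` {..n}) - 1" and "b = Max (x ` {..n}) + 1"
  have ab: "x i \<in> {a<..<b}" if "i \<le> n" for i
  proof -
    have "Min (x ` {..n}) \<le> x i" "x i \<le> Max (x ` {..n})" using that by auto
    then show ?thesis by (auto simp: a_def b_def)
  qed
  have "inj_on x {..<n}" using assms(3) by (rule inj_on_subset) auto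
  then have v: "search_tree m a b (build m n x)" "keys (build m n x) = x ` {..<n}"
    using search_tree_build[OF \<open>m \<ge> 2\<close>, of x n a b] ab by auto
  have "x n \<notin> x ` {..<n}" by (auto dest: inj_onD[OF assms(3)])
  then show thesis
    using gaps_ins[OF \<open>m \<ge> 2\<close> v(1) build_ne_Leaf[OF \<open>n \<ge> 1\<close>], of "x n"] ab[of n] v(2)
    by (intro that[of "hit m (x n) (build m n x)"]) (auto simp: gapvec_def build_Suc)
qed

lemma chi_square_cong: "(\<And>k. k \<in> {1..N} \<Longrightarrow> f k = g k) \<Longrightarrow> chi_square N v f = chi_square N v g"
  by (simp add: chi_square_def)

text \<open>The \<open>n + 1\<close> gaps of a tree on the keys \<open>0, \<dots>, n - 1\<close> are represented by the new keys
  \<open>r - 1/2\<close> for \<open>r = 0, \<dots>, n\<close>.\<close>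

lemma sum_hit_build:
  fixes f :: "nat \<Rightarrow> real"
  assumes "m \<ge> 2" "n \<ge> 1" "\<pi> permutes {..<n}"
  shows "(\<Sum>r\<le>n. f (hit m (real r - 1/2) (build m n (\<lambda>i. real (\<pi> i)))))
    = (\<Sum>q=1..2*m-2. gapvec m (\<lambda>i. real (\<pi> i)) n q * f q)"
    and "search_tree m (-1) (real n) (build m n (\<lambda>i. real (\<pi> i)))"
    and "keys (build m n (\<lambda>i. real (\<pi> i))) = real ` {..<n}"
proof -
  let ?t = "build m n (\<lambda>i. real (\<pi> i))"
  have im: "\<pi> ` {..<n} = {..<n}" using assms(3) by (rule permutes_image)
  then have "\<pi> i < n" if "i < n" for i using that by auto
  moreover have "inj_on (\<lambda>i. real (\<pi> i)) {..<n}"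
    using permutes_inj[OF assms(3)] by (auto simp: inj_on_def)
  ultimately have v: "search_tree m (-1) (real n) ?t" "keys ?t = (\<lambda>i. real (\<pi> i)) ` {..<n}"
    using search_tree_build[OF \<open>m \<ge> 2\<close>, of "\<lambda>i. real (\<pi> i)" n "-1" "real n"] by auto
  show "search_tree m (-1) (real n) ?t" by (rule v)
  show keys: "keys ?t = real ` {..<n}"
    unfolding v(2) using im by (auto simp: image_image[symmetric] simp del: image_image)
  \<comment> \<open>Rank \<open>r\<close> is matched with the label \<open>r - 1\<close>, and the
    floor recovers \<open>r\<close>; the label -1 is the gap below all keys.\<close>
  have "\<lfloor>- 1 :: real\<rfloor> = - 1" by (simp add: floor_eq_iff)
  then have "(\<Sum>r\<le>n. f (hit m (real r - 1/2) ?t)) = (\<Sum>y\<in>insert (-1) (real ` {..<n}). f (hit m (y + 1/2) ?t))"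
  proof (intro sum.reindex_bij_witness[of _ "\<lambda>y. nat \<lfloor>y + 1\<rfloor>" "\<lambda>r. real r - 1"])
    fix r assume "r \<in> {..n}"
    then show "real r - 1 \<in> insert (-1) (real ` {..<n})"
      by (cases r) auto
  qed (auto simp: field_simps)
  also have "\<dots> = (\<Sum>q=1..2*m-2. real (gaps m (gap_type m q) ?t) * f q)"
    unfolding keys[symmetric]
  proof (rule sum_hit[OF \<open>m \<ge> 2\<close> v(1) build_ne_Leaf[OF \<open>n \<ge> 1\<close>]])
    fix y k assume "y \<in> insert (-1) (keys ?t)" "k \<in> keys ?t"
    then obtain k' where k': "k = real k'" and y: "y = -1 \<or> (\<exists>y'. y = real y')" by (auto simp: keys)
    from y show "k < y + 1/2 \<longleftrightarrow> k \<le> y"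
    proof
      assume "\<exists>y'. y = real y'"
      then obtain y' where y': "y = real y'" ..
      show ?thesis
      proof (cases "k' \<le> y'")
        case False
        then have "real k' \<ge> real y' + 1" by linarith
        then show ?thesis by (simp add: k' y')
      qed (simp add: k' y')
    qed (simp add: k')
  qed simp
  finally show "(\<Sum>r\<le>n. f (hit m (real r - 1/2) ?t))
    = (\<Sum>q=1..2*m-2. gapvec m (\<lambda>i. real (\<pi> i)) n q * f q)"
    by (simp add: gapvec_def)
qed

text \<open>Each of the \<open>n + 1\<close> positions of a new key is counted with weight
  1.\<close>

lemma gapvec_total:
  assumes "m \<ge> 2" "n \<ge> 1" "\<pi> permutes {..<n}"
  shows "(\<Sum>q=1..2*m-2. gapvec m (\<lambda>i. real (\<pi> i)) n q) = real n + 1"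
  using sum_hit_build(1)[OF assms, of "\<lambda>_. 1"] by simp

text \<open>Group the \<open>n + 1\<close> positions of the new key by the level that they hit:
  level \<open>q\<close> is hit from \<open>gapvec m x n q\<close> of them. This identifies uniform
  insertion with a draw from the urn.\<close>

lemma sum_chi_square_insert:
  assumes "m \<ge> 2" "n \<ge> 1" "\<pi> permutes {..<n}"
  defines "x \<equiv> \<lambda>i. real (\<pi> i)"
  shows "(\<Sum>r\<le>n. chi_square (2*m-2) v (\<lambda>k. gapvec m (x(n := real r - 1/2)) (Suc n) k - w k))
    = (\<Sum>q=1..2*m-2. gapvec m x n q * chi_square (2*m-2) v (\<lambda>k. gapvec m x n k + replacement m q k - w k))"
  unfolding x_def sum_hit_build(1)[OF assms(1-3), symmetric]
proof (intro sum.cong refl chi_square_cong)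
  fix r k assume r: "r \<in> {..n}" and k: "k \<in> {1..2*m-2}"
  let ?t = "build m n (\<lambda>i. real (\<pi> i))" and ?z = "real r - 1/2"
  have "?z \<noteq> real i" for i
  proof
    assume "?z = real i"
    then have "2 * r = 2 * i + 1" by linarith
    then show False by presburger
  qed
  then have "?z \<notin> keys ?t" unfolding sum_hit_build(3)[OF assms(1-3)] by auto
  moreover have "-1 < ?z" "?z < real n \<or> ?z < real n" using r by auto
  ultimately have "real (gaps m (gap_type m k) (ins m ?z ?t)) = real (gaps m (gap_type m k) ?t) + replacement m (hit m ?z ?t) k"
    using gaps_ins[OF assms(1) sum_hit_build(2)[OF assms(1-3)] build_ne_Leaf[OF assms(2)], of ?z k] k by auto
  moreover have "build m n ((\<lambda>i. real (\<pi> i))(n := ?z)) = ?t" by (intro build_cong) auto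
  ultimately show "gapvec m ((\<lambda>i. real (\<pi> i))(n := ?z)) (Suc n) k - w k
      = gapvec m (\<lambda>i. real (\<pi> i)) n k + replacement m (hit m ?z ?t) k - w k"
    by (simp add: gapvec_def build_Suc)
qed

section \<open>Uniformly random ranks\<close>

definition key_rank :: "(nat \<Rightarrow> real) \<Rightarrow> nat \<Rightarrow> nat \<Rightarrow> nat" where
  "key_rank x n i = card {j. j < n \<and> x j < x i}"

lemma key_rank_less_iff:
  assumes "i < n" "j < n" shows "key_rank x n i < key_rank x n j \<longleftrightarrow> x i < x j"
proof -
  have *: "x i < x j \<Longrightarrow> key_rank x n i < key_rank x n j" if "i < n" for i j
    unfolding key_rank_def by (intro psubset_card_mono) (use that in auto)
  have "key_rank x n j \<le> key_rank x n i" if "x j \<le> x i"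
    unfolding key_rank_def by (intro card_mono) (use that in auto)
  then show ?thesis using *[OF assms(1), of j] by (meson leD linorder_le_less_linear)
qed

lemma key_rank_cong: "(\<And>k. k < n \<Longrightarrow> x k = y k) \<Longrightarrow> i < n \<Longrightarrow> key_rank x n i = key_rank y n i"
  unfolding key_rank_def by (intro arg_cong[where f=card]) auto

lemma key_rank_permute:
  assumes "\<pi> permutes {..<n}" "i < n"
  shows "key_rank (\<lambda>k. x (\<pi> k)) n i = key_rank x n (\<pi> i)"
proof -
  have "{j. j < n \<and> x j < x (\<pi> i)} = \<pi> ` {j. j < n \<and> x (\<pi> j) < x (\<pi> i)}"
    using permutes_image[OF assms(1)] by (auto simp: set_eq_iff image_iff) (metis lessThan_iff)+
  moreover have "inj_on \<pi> A" for A using permutes_inj[OF assms(1)] by (rule inj_on_subset) auto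
  ultimately show ?thesis unfolding key_rank_def by (simp add: card_image)
qed

lemma key_rank_permutes:
  assumes "inj_on x {..<n}"
  shows "(\<lambda>i. if i < n then key_rank x n i else i) permutes {..<n}"
proof (rule bij_imp_permutes)
  let ?f = "\<lambda>i. if i < n then key_rank x n i else i"
  have inj: "inj_on ?f {..<n}"
  proof (rule inj_onI)
    fix i j assume "i \<in> {..<n}" "j \<in> {..<n}" "?f i = ?f j"
    then have "x i = x j" using key_rank_less_iff[of i n j x] key_rank_less_iff[of j n i x] by auto
    then show "i = j" using assms \<open>i \<in> {..<n}\<close> \<open>j \<in> {..<n}\<close> by (auto dest: inj_onD)
  qed
  have "key_rank x n i < n" if "i < n" for i
  proof -
    have "key_rank x n i < card {..<n}"
      unfolding key_rank_def using that by (intro psubset_card_mono) auto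
    then show ?thesis by simp
  qed
  then have "?f ` {..<n} \<subseteq> {..<n}" by auto
  then show "bij_betw ?f {..<n} {..<n}"
    using inj endo_inj_surj[OF finite_lessThan _ inj] by (simp add: bij_betw_def)
qed auto

text \<open>Encodes a ranking of \<open>n + 1\<close> keys by the rank of the last key and the
  relative ranks of the others; old ranks from \<open>r\<close> on move up to make room.\<close>

definition insert_rank :: "nat \<Rightarrow> nat \<Rightarrow> (nat \<Rightarrow> nat) \<Rightarrow> nat \<Rightarrow> nat" where
  "insert_rank n r \<pi> i = (if i < n then (if r \<le> \<pi> i then Suc (\<pi> i) else \<pi> i) else if i = n then r else i)"

lemma insert_rank_permutes:
  assumes "\<pi> permutes {..<n}" "r \<le> n"
  shows "insert_rank n r \<pi> permutes {..<Suc n}"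
proof (rule bij_imp_permutes)
  have \<pi>: "\<pi> i < n" if "i < n" for i using permutes_in_image[OF assms(1), of i] that by simp
  have "inj_on (insert_rank n r \<pi>) {..<Suc n}"
  proof (rule inj_onI)
    fix i j assume "i \<in> {..<Suc n}" "j \<in> {..<Suc n}" "insert_rank n r \<pi> i = insert_rank n r \<pi> j"
    then show "i = j"
      using permutes_inj[OF assms(1), THEN injD, of i j]
      by (auto simp: insert_rank_def split: if_splits)
  qed
  moreover have "insert_rank n r \<pi> ` {..<Suc n} \<subseteq> {..<Suc n}"
    using \<pi> assms(2) by (force simp: insert_rank_def)
  ultimately show "bij_betw (insert_rank n r \<pi>) {..<Suc n} {..<Suc n}"
    by (simp add: bij_betw_def endo_inj_surj)
qed (auto simp: insert_rank_def)

lemma insert_rank_inj: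
  assumes "\<pi> permutes {..<n}" "\<pi>' permutes {..<n}" "insert_rank n r \<pi> = insert_rank n r' \<pi>'"
  shows "r = r' \<and> \<pi> = \<pi>'"
proof -
  have r: "r = r'" using fun_cong[OF assms(3), of n] by (simp add: insert_rank_def)
  have "\<pi> i = \<pi>' i" for i
  proof (cases "i < n")
    case True
    then show ?thesis
      using fun_cong[OF assms(3), of i] r by (auto simp: insert_rank_def split: if_splits)
  next
    case False
    then show ?thesis using assms(1,2) by (simp add: permutes_not_in)
  qed
  with r show ?thesis by auto
qed

text \<open>The encoding by \<open>insert_rank\<close> is injective and the numbers of elements
  agree, \<open>(n + 1) n! = (n + 1)!\<close>, so it is a bijection without exhibiting an
  inverse.\<close>

lemma sum_permutations_Suc:
  fixes f :: "(nat \<Rightarrow> nat) \<Rightarrow> real"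
  shows "(\<Sum>\<sigma> | \<sigma> permutes {..<Suc n}. f \<sigma>)
    = (\<Sum>\<pi> | \<pi> permutes {..<n}. \<Sum>r\<le>n. f (insert_rank n r \<pi>))"
proof -
  let ?P = "{\<pi>. \<pi> permutes {..<n}} \<times> {..n}" and ?g = "\<lambda>(\<pi>, r). insert_rank n r \<pi>"
  have fin: "finite {\<pi>. \<pi> permutes {..<k}}" for k :: nat by (simp add: finite_permutations)
  have inj: "inj_on ?g ?P" using insert_rank_inj by (fastforce intro!: inj_onI)
  have sub: "?g ` ?P \<subseteq> {\<sigma>. \<sigma> permutes {..<Suc n}}" using insert_rank_permutes by auto
  have "card (?g ` ?P) = card {\<sigma>. \<sigma> permutes {..<Suc n}}"
    using inj card_permutations[of "{..<n}" n] card_permutations[of "{..<Suc n}" "Suc n"]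
    by (simp add: card_image card_cartesian_product)
  then have "?g ` ?P = {\<sigma>. \<sigma> permutes {..<Suc n}}" by (rule card_subset_eq[OF fin sub])
  then have "(\<Sum>\<sigma> | \<sigma> permutes {..<Suc n}. f \<sigma>) = (\<Sum>p\<in>?P. f (?g p))"
    using sum.reindex[OF inj, of f] by (simp add: o_def)
  then show ?thesis by (simp add: sum.cartesian_product case_prod_beta)
qed

section \<open>The mean deviation over random permutations\<close>

definition deviation :: "nat \<Rightarrow> nat \<Rightarrow> (nat \<Rightarrow> real) \<Rightarrow> real" where
  "deviation m n x = chi_square (2*m-2) (\<lambda>p. limvec m (gap_type m p))
     (\<lambda>k. gapvec m x n k - (real n + 1) * limvec m (gap_type m k))"

text \<open>The expected deviation as a finite average, so that its recursion in \<open>n\<close> is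
  pure counting and probability enters only afterwards.\<close>

definition mean_deviation :: "nat \<Rightarrow> nat \<Rightarrow> real" where
  "mean_deviation m n = (\<Sum>\<pi> | \<pi> permutes {..<n}. deviation m n (\<lambda>i. real (\<pi> i))) / fact n"

lemma deviation_nonneg: "m \<ge> 2 \<Longrightarrow> 0 \<le> deviation m n x"
  unfolding deviation_def chi_square_def
  by (intro sum_nonneg divide_nonneg_pos zero_le_power2 limvec_pos) auto

lemma deviation_order_iso:
  "(\<And>i j. i < n \<Longrightarrow> j < n \<Longrightarrow> x i < x j \<longleftrightarrow> y i < y j) \<Longrightarrow> deviation m n x = deviation m n y"
  unfolding deviation_def by (subst gapvec_order_iso[of n x y]) auto

text \<open>The key \<open>r - 1/2\<close> compares with the old ranks as the new rank
  \<open>r\<close> does with the shifted ones, and the deviation depends only on the order.\<close>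

lemma deviation_insert_rank:
  assumes "\<pi> permutes {..<n}"
  shows "deviation m (Suc n) (\<lambda>i. real (insert_rank n r \<pi> i))
    = deviation m (Suc n) ((\<lambda>i. real (\<pi> i))(n := real r - 1/2))"
proof (rule deviation_order_iso)
  have half: "real a < real b - 1/2 \<longleftrightarrow> a < b" "real b - 1/2 < real a \<longleftrightarrow> b \<le> a" for a b :: nat
  proof -
    show "real a < real b - 1/2 \<longleftrightarrow> a < b"
    proof (cases "a < b")
      case True
      then have "real a + 1 \<le> real b" by linarith
      then show ?thesis using True by simp
    qed simp
    show "real b - 1/2 < real a \<longleftrightarrow> b \<le> a"
    proof (cases "b \<le> a")
      case False
      then have "real a + 1 \<le> real b" by linarith
      then show ?thesis using False by simp
    qed simp
  qed
  fix i j assume "i < Suc n" "j < Suc n"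
  then show "real (insert_rank n r \<pi> i) < real (insert_rank n r \<pi> j) \<longleftrightarrow>
    ((\<lambda>i. real (\<pi> i))(n := real r - 1/2)) i < ((\<lambda>i. real (\<pi> i))(n := real r - 1/2)) j"
    using half by (cases "i = n"; cases "j = n") (auto simp: insert_rank_def)
qed

text \<open>Sum \<open>urn_drift\<close> over all permutations, each with all ranks of the next key.
  Dividing by \<open>(n+1)!\<close> turns the factor \<open>T + 2 (1 - c)\<close> into
  \<open>1 + 2 (1 - c) / T\<close> for \<open>T = n + 1\<close>, the recursion of
  \<open>summable_of_drift\<close>.\<close>

lemma summable_mean_deviation:
  assumes "m \<ge> 2"
  shows "summable (\<lambda>n. mean_deviation m n / (real n + 1) ^ 3)"
proof -
  interpret urn_chain "2*m-2" "\<lambda>p. limvec m (gap_type m p)" "replacement m"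
    using assms by (rule urn_chain_search_tree)
  obtain c C where c: "0 < c" "c \<le> 1/3" "0 \<le> C" and drift:
    "\<And>X T. (\<And>q. q \<in> {1..2*m-2} \<Longrightarrow> 0 \<le> X q) \<Longrightarrow> (\<Sum>q=1..2*m-2. X q) = T \<Longrightarrow>
       (\<Sum>q=1..2*m-2. X q * chi_square (2*m-2) (\<lambda>p. limvec m (gap_type m p)) (\<lambda>k. X k + replacement m q k - (T + 1) * limvec m (gap_type m k)))
       \<le> (T + 2 * (1 - c)) * chi_square (2*m-2) (\<lambda>p. limvec m (gap_type m p)) (\<lambda>k. X k - T * limvec m (gap_type m k)) + T * C"
    by (rule urn_drift) blast
  show ?thesis
  proof (rule summable_of_drift[OF _ c])
    show "0 \<le> mean_deviation m n" for n
      unfolding mean_deviation_def using deviation_nonneg[OF assms] by (intro divide_nonneg_pos sum_nonneg) auto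
  next
    fix n :: nat assume n: "n \<ge> 1"
    let ?P = "{\<pi>. \<pi> permutes {..<n}}" and ?T = "real n + 1"
    have "(\<Sum>r\<le>n. deviation m (Suc n) (\<lambda>i. real (insert_rank n r \<pi> i)))
       \<le> (?T + 2 * (1 - c)) * deviation m n (\<lambda>i. real (\<pi> i)) + ?T * C" if \<pi>: "\<pi> permutes {..<n}" for \<pi>
    proof -
      let ?x = "\<lambda>i. real (\<pi> i)"
      have "(\<Sum>r\<le>n. deviation m (Suc n) (\<lambda>i. real (insert_rank n r \<pi> i)))
        = (\<Sum>r\<le>n. chi_square (2*m-2) (\<lambda>p. limvec m (gap_type m p))
             (\<lambda>k. gapvec m (?x(n := real r - 1/2)) (Suc n) k - (?T + 1) * limvec m (gap_type m k)))"
        unfolding deviation_insert_rank[OF \<pi>] unfolding deviation_def by (simp add: add_ac)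
      also have "\<dots> = (\<Sum>q=1..2*m-2. gapvec m ?x n q * chi_square (2*m-2) (\<lambda>p. limvec m (gap_type m p))
             (\<lambda>k. gapvec m ?x n k + replacement m q k - (?T + 1) * limvec m (gap_type m k)))"
        by (rule sum_chi_square_insert[OF assms n \<pi>])
      also have "\<dots> \<le> (?T + 2 * (1 - c)) * deviation m n ?x + ?T * C"
        unfolding deviation_def using gapvec_total[OF assms n \<pi>]
        by (intro drift) (auto simp: gapvec_def)
      finally show ?thesis .
    qed
    then have "(\<Sum>\<pi>\<in>?P. \<Sum>r\<le>n. deviation m (Suc n) (\<lambda>i. real (insert_rank n r \<pi> i)))
      \<le> (\<Sum>\<pi>\<in>?P. (?T + 2 * (1 - c)) * deviation m n (\<lambda>i. real (\<pi> i)) + ?T * C)"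
      by (intro sum_mono) auto
    also have "\<dots> = (?T + 2 * (1 - c)) * (\<Sum>\<pi>\<in>?P. deviation m n (\<lambda>i. real (\<pi> i))) + fact n * (?T * C)"
      by (simp add: sum.distrib sum_distrib_left card_permutations[of "{..<n}" n])
    also have "\<dots> = fact n * ((?T + 2 * (1 - c)) * mean_deviation m n + ?T * C)"
      by (simp add: mean_deviation_def distrib_left)
    finally have "mean_deviation m (Suc n)
      \<le> fact n * ((?T + 2 * (1 - c)) * mean_deviation m n + ?T * C) / fact (Suc n)"
      unfolding mean_deviation_def[of m "Suc n"] sum_permutations_Suc by (rule divide_right_mono) simp
    also have "\<dots> = ((?T + 2 * (1 - c)) * mean_deviation m n + ?T * C) / ?T"
      by (simp add: add.commute)
    also have "\<dots> = (1 + 2 * (1 - c) / ?T) * mean_deviation m n + C"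
    proof -
      have "?T > 0" by simp
      then show ?thesis by (simp add: field_simps)
    qed
    finally show "mean_deviation m (Suc n) \<le> (1 + 2 * (1 - c) / (real n + 1)) * mean_deviation m n + C" .
  qed
qed

section \<open>Ranks of independent, identically distributed keys\<close>

text \<open>A rank is a finite sum of comparison indicators. The space \<open>N\<close> is arbitrary
  because both the sample space and the product space of the first \<open>n\<close> keys
  occur.\<close>

lemma measurable_ranks:
  fixes X :: "'b \<Rightarrow> nat \<Rightarrow> real"
  assumes "\<And>i. i < n \<Longrightarrow> (\<lambda>w. X w i) \<in> borel_measurable N"
  shows "{w \<in> space N. \<forall>i<n. key_rank (X w) n i = \<pi> i} \<in> sets N"
proof -
  have key_rank: "real (key_rank (X w) n i) = (\<Sum>j<n. if X w j < X w i then 1 else 0)" for w i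
  proof -
    have "{j. j < n \<and> X w j < X w i} = {..<n} \<inter> {j. X w j < X w i}" by auto
    then show ?thesis by (simp add: key_rank_def sum.If_cases)
  qed
  have "(\<lambda>w. real (key_rank (X w) n i)) \<in> borel_measurable N" if "i < n" for i
    unfolding key_rank using assms that
    by (intro borel_measurable_sum measurable_If borel_measurable_const) (auto intro!: borel_measurable_less)
  then have "{w \<in> space N. \<forall>i\<in>{..<n}. real (key_rank (X w) n i) = real (\<pi> i)} \<in> sets N"
    by (intro sets.sets_Collect_finite_All borel_measurable_eq borel_measurable_const) auto
  also have "{w \<in> space N. \<forall>i\<in>{..<n}. real (key_rank (X w) n i) = real (\<pi> i)}
      = {w \<in> space N. \<forall>i<n. key_rank (X w) n i = \<pi> i}"
    by auto
  finally show ?thesis .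
qed

context prob_space
begin

text \<open>By Fubini the diagonal is null for a product of diffuse laws, and there are only
  countably many pairs of indices.\<close>

lemma AE_inj_of_indep:
  fixes U :: "nat \<Rightarrow> 'a \<Rightarrow> real"
  assumes indep: "indep_vars (\<lambda>_. borel) U UNIV"
    and diffuse: "\<And>k x. emeasure (distr M borel (U k)) {x} = 0"
  shows "AE \<omega> in M. inj (\<lambda>k. U k \<omega>)"
proof -
  have rv[measurable]: "random_variable borel (U k)" for k
    using indep by (auto simp: indep_vars_def)
  have "AE \<omega> in M. i \<noteq> j \<longrightarrow> U i \<omega> \<noteq> U j \<omega>" for i j
  proof (cases "i = j")
    case False
    interpret Dj: prob_space "distr M borel (U j)" by (rule prob_space_distr) (rule rv)
    let ?D = "{p :: real \<times> real. fst p = snd p}"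
    have D: "?D \<in> sets (borel \<Otimes>\<^sub>M borel)"
      unfolding borel_prod by (intro borel_closed closed_Collect_eq continuous_intros)
    have "indep_var borel ((\<lambda>f. f i) \<circ> (\<lambda>\<omega>. restrict (\<lambda>k. U k \<omega>) {i}))
        borel ((\<lambda>f. f j) \<circ> (\<lambda>\<omega>. restrict (\<lambda>k. U k \<omega>) {j}))"
      using indep_var_restrict[OF indep, of "{i}" "{j}"] False
      by (intro indep_var_compose) (auto intro: measurable_component_singleton)
    then have "indep_var borel (U i) borel (U j)" by (simp add: o_def)
    then have eq: "distr M borel (U i) \<Otimes>\<^sub>M distr M borel (U j) = distr M (borel \<Otimes>\<^sub>M borel) (\<lambda>\<omega>. (U i \<omega>, U j \<omega>))"
      by (simp add: indep_var_distribution_eq)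
    have "emeasure M {\<omega> \<in> space M. U i \<omega> = U j \<omega>}
        = emeasure (distr M (borel \<Otimes>\<^sub>M borel) (\<lambda>\<omega>. (U i \<omega>, U j \<omega>))) ?D"
      using D by (subst emeasure_distr) (auto intro!: arg_cong[where f="emeasure M"])
    also have "\<dots> = (\<integral>\<^sup>+x. emeasure (distr M borel (U j)) (Pair x -` ?D) \<partial>distr M borel (U i))"
      unfolding eq[symmetric] using D by (subst Dj.emeasure_pair_measure_alt) (auto cong: sets_pair_measure_cong)
    also have "\<dots> = 0"
    proof -
      have "Pair x -` ?D = {x}" for x :: real by auto
      then show ?thesis by (simp add: diffuse)
    qed
    finally have "AE \<omega> in M. \<not> U i \<omega> = U j \<omega>"
      by (intro AE_I[where N="{\<omega> \<in> space M. U i \<omega> = U j \<omega>}"]) auto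
    then show ?thesis by simp
  qed simp
  then have "AE \<omega> in M. \<forall>i j. i \<noteq> j \<longrightarrow> U i \<omega> \<noteq> U j \<omega>"
    by (simp add: AE_all_countable)
  then show ?thesis by eventually_elim (auto simp: inj_def)
qed

text \<open>The joint law of the first \<open>n\<close> keys is a product of equal factors, hence
  invariant under permuting coordinates, so all \<open>n!\<close> rank patterns are equally likely.
  Almost sure distinctness makes them exhaust the space.\<close>

lemma prob_ranks:
  fixes U :: "nat \<Rightarrow> 'a \<Rightarrow> real"
  assumes indep: "indep_vars (\<lambda>_. borel) U UNIV" and id: "\<And>k. distr M borel (U k) = D"
    and inj: "AE \<omega> in M. inj (\<lambda>k. U k \<omega>)" and \<pi>: "\<pi> permutes {..<n}"
  shows "prob {\<omega> \<in> space M. \<forall>i<n. key_rank (\<lambda>k. U k \<omega>) n i = \<pi> i} = 1 / fact n"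
proof (cases "n = 0")
  case False
  have rv[measurable]: "random_variable borel (U k)" for k
    using indep by (auto simp: indep_vars_def)
  define E where "E \<sigma> = {\<omega> \<in> space M. \<forall>i<n. key_rank (\<lambda>k. U k \<omega>) n i = \<sigma> i}" for \<sigma>
  have E: "E \<sigma> \<in> events" for \<sigma>
    unfolding E_def by (rule measurable_ranks) simp
  let ?B = "Pi\<^sub>M {..<n} (\<lambda>_. borel :: real measure)"
  define A where "A \<sigma> = {f \<in> space ?B. \<forall>i<n. key_rank f n i = \<sigma> i}" for \<sigma>
  have A: "A \<sigma> \<in> sets ?B" for \<sigma>
    unfolding A_def by (rule measurable_ranks) (auto intro: measurable_component_singleton)
  define P where "P = Pi\<^sub>M {..<n} (\<lambda>_. D)"
  have setsD: "sets D = sets borel" using id[of 0] by (metis sets_distr)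
  have D: "prob_space D" using prob_space_distr[OF rv, of 0] id by simp
  have setsP: "sets P = sets ?B" unfolding P_def using setsD by (intro sets_PiM_cong) auto
  then have spaceP: "space P = space ?B" by (rule sets_eq_imp_space_eq)
  have X: "(\<lambda>\<omega>. \<lambda>i\<in>{..<n}. U i \<omega>) \<in> measurable M ?B" by (intro measurable_restrict) simp
  have distr: "distr M ?B (\<lambda>\<omega>. \<lambda>i\<in>{..<n}. U i \<omega>) = P"
    unfolding P_def using indep_vars_iff_distr_eq_PiM'[where I="{..<n}" and X=U and M'="\<lambda>_. borel"] False
      indep_vars_subset[OF indep, of "{..<n}"] id by auto
  have EA: "prob (E \<sigma>) = measure P (A \<sigma>)" for \<sigma>
  proof -
    have "measure P (A \<sigma>) = prob ((\<lambda>\<omega>. \<lambda>i\<in>{..<n}. U i \<omega>) -` A \<sigma> \<inter> space M)"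
      unfolding distr[symmetric] by (rule measure_distr[OF X A])
    also have "(\<lambda>\<omega>. \<lambda>i\<in>{..<n}. U i \<omega>) -` A \<sigma> \<inter> space M = E \<sigma>"
      using measurable_space[OF X] key_rank_cong[of n "\<lambda>i\<in>{..<n}. U i w" "\<lambda>i. U i w" for w]
      by (auto simp: A_def E_def)
    finally show ?thesis ..
  qed
  have same: "prob (E \<sigma>) = prob (E (\<lambda>i. i))" if \<sigma>: "\<sigma> permutes {..<n}" for \<sigma>
  proof -
    \<comment> \<open>Reindexing the coordinates by \<sigma> preserves \<open>P\<close> and pulls
      the rank pattern \<sigma> back to the identity pattern.\<close>
    let ?S = "\<lambda>f. \<lambda>i\<in>{..<n}. f (\<sigma> i)"
    have \<sigma>n: "\<sigma> i < n" if "i < n" for i using permutes_in_image[OF \<sigma>, of i] that by simp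
    have S: "?S \<in> measurable P ?B"
      unfolding measurable_cong_sets[OF setsP refl]
      using \<sigma>n by (intro measurable_restrict measurable_component_singleton) auto
    have "distr P (Pi\<^sub>M {..<n} (\<lambda>i. D)) ?S = Pi\<^sub>M {..<n} (\<lambda>i. D)"
      unfolding P_def using D permutes_inj[OF \<sigma>] \<sigma>n
      by (intro distr_PiM_reindex) (auto intro: inj_on_subset)
    then have "distr P ?B ?S = P"
      using setsP by (simp add: P_def cong: distr_cong)
    then have "measure P (A \<sigma>) = measure (distr P ?B ?S) (A \<sigma>)" by simp
    also have "\<dots> = measure P (?S -` A \<sigma> \<inter> space P)"
      by (rule measure_distr[OF S A])
    also have "?S -` A \<sigma> \<inter> space P = A (\<lambda>i. i)"
    proof -
      have "(\<forall>i<n. key_rank (?S f) n i = \<sigma> i) \<longleftrightarrow> (\<forall>i<n. key_rank f n i = i)" for f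
      proof -
        have "key_rank (?S f) n i = key_rank f n (\<sigma> i)" if "i < n" for i
          using key_rank_permute[OF \<sigma> that, of f] key_rank_cong[of n "?S f" "\<lambda>k. f (\<sigma> k)" i] that by simp
        then have "(\<forall>i<n. key_rank (?S f) n i = \<sigma> i) \<longleftrightarrow> (\<forall>i\<in>\<sigma> ` {..<n}. key_rank f n i = i)" by auto
        then show ?thesis unfolding permutes_image[OF \<sigma>] by auto
      qed
      moreover have "?S f \<in> space ?B" if "f \<in> space P" for f
        using measurable_space[OF S that] .
      ultimately show ?thesis by (auto simp: A_def spaceP)
    qed
    finally show ?thesis by (simp add: EA)
  qed
  let ?Q = "{\<sigma>. \<sigma> permutes {..<n}}"
  have fin: "finite ?Q" by (simp add: finite_permutations)
  have disj: "disjoint_family_on E ?Q"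
    unfolding disjoint_family_on_def
  proof (intro ballI impI)
    fix \<sigma> \<tau> assume "\<sigma> \<in> ?Q" "\<tau> \<in> ?Q" "\<sigma> \<noteq> \<tau>"
    then obtain i where "\<sigma> i \<noteq> \<tau> i" "i < n"
      by (metis ext lessThan_iff mem_Collect_eq permutes_not_in)
    then show "E \<sigma> \<inter> E \<tau> = {}" by (auto simp: E_def)
  qed
  have "AE \<omega> in M. \<omega> \<in> (\<Union>\<sigma>\<in>?Q. E \<sigma>)"
    using inj AE_space
  proof eventually_elim
    case (elim \<omega>)
    have "(\<lambda>i. if i < n then key_rank (\<lambda>k. U k \<omega>) n i else i) permutes {..<n}"
      using elim by (intro key_rank_permutes) (auto intro: inj_on_subset)
    then show ?case using elim by (auto simp: E_def intro!: exI)
  qed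
  then have "prob (\<Union>\<sigma>\<in>?Q. E \<sigma>) = 1"
    using E fin by (subst prob_eq_1) auto
  moreover have "prob (\<Union>\<sigma>\<in>?Q. E \<sigma>) = (\<Sum>\<sigma>\<in>?Q. prob (E \<sigma>))"
    using E by (intro finite_measure_finite_Union[OF fin _ disj]) auto
  moreover have "(\<Sum>\<sigma>\<in>?Q. prob (E \<sigma>)) = fact n * prob (E (\<lambda>i. i))"
    using same by (simp add: card_permutations[of "{..<n}" n])
  ultimately have "prob (E (\<lambda>i. i)) = 1 / fact n" by (simp add: field_simps)
  then show ?thesis using same[OF \<pi>] by (simp add: E_def)
qed (simp add: prob_space)

text \<open>The means have a finite sum, so by monotone convergence the random series has a finite
  mean and is finite almost surely.\<close>

lemma AE_summable_deviation:
  fixes U :: "nat \<Rightarrow> 'a \<Rightarrow> real"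
  assumes m: "m \<ge> 2" and indep: "indep_vars (\<lambda>_. borel) U UNIV" and id: "\<And>k. distr M borel (U k) = D"
    and inj: "AE \<omega> in M. inj (\<lambda>k. U k \<omega>)"
  shows "AE \<omega> in M. summable (\<lambda>n. deviation m n (\<lambda>k. U k \<omega>) / (real n + 1) ^ 3)"
proof -
  have rv[measurable]: "random_variable borel (U k)" for k
    using indep by (auto simp: indep_vars_def)
  let ?Q = "\<lambda>n :: nat. {\<pi>. \<pi> permutes {..<n}}"
  define E where "E n \<pi> = {\<omega> \<in> space M. \<forall>i<n. key_rank (\<lambda>k. U k \<omega>) n i = \<pi> i}" for n \<pi>
  have E[measurable]: "E n \<pi> \<in> events" for n \<pi>
    unfolding E_def by (rule measurable_ranks) simp
  have PE: "prob (E n \<pi>) = 1 / fact n" if "\<pi> permutes {..<n}" for n \<pi>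
    unfolding E_def by (rule prob_ranks[OF indep id inj that])
  have fin: "finite (?Q n)" for n by (simp add: finite_permutations)
  \<comment> \<open>A version of the scaled deviation that is visibly measurable, with mean given by
    \<open>mean_deviation\<close>. On distinct keys it is the scaled deviation itself, as exactly
    one rank pattern occurs.\<close>
  define V where "V n \<omega> = (\<Sum>\<pi>\<in>?Q n. deviation m n (\<lambda>i. real (\<pi> i)) * indicator (E n \<pi>) \<omega>) / (real n + 1) ^ 3" for n \<omega>
  have V0: "0 \<le> V n \<omega>" for n \<omega>
    unfolding V_def using deviation_nonneg[OF m] by (intro divide_nonneg_pos sum_nonneg) auto
  have V_meas[measurable]: "V n \<in> borel_measurable M" for n
    unfolding V_def by measurable
  have int: "integrable M (V n)" for n
    unfolding V_def by (intro integrable_divide integrable_sum integrable_mult_right integrable_real_indicator)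
      (auto simp: less_top[symmetric])
  have "expectation (V n) = mean_deviation m n / (real n + 1) ^ 3" for n
  proof -
    have "expectation (V n) = (\<Sum>\<pi>\<in>?Q n. deviation m n (\<lambda>i. real (\<pi> i)) * prob (E n \<pi>)) / (real n + 1) ^ 3"
      unfolding V_def
      by (subst integral_divide_zero, subst Bochner_Integration.integral_sum)
         (auto simp: less_top[symmetric] intro!: integrable_mult_right integrable_real_indicator)
    also have "\<dots> = mean_deviation m n / (real n + 1) ^ 3"
      by (simp add: PE mean_deviation_def sum_divide_distrib)
    finally show ?thesis .
  qed
  then have nn: "(\<integral>\<^sup>+\<omega>. ennreal (V n \<omega>) \<partial>M) = ennreal (mean_deviation m n / (real n + 1) ^ 3)" for n
    using nn_integral_eq_integral[OF int] V0 by simp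
  have md0: "0 \<le> mean_deviation m n / (real n + 1) ^ 3" for n
    unfolding mean_deviation_def using deviation_nonneg[OF m] by (intro divide_nonneg_pos sum_nonneg) auto
  have "(\<integral>\<^sup>+\<omega>. (\<Sum>n. ennreal (V n \<omega>)) \<partial>M) = (\<Sum>n. ennreal (mean_deviation m n / (real n + 1) ^ 3))"
    by (subst nn_integral_suminf) (auto simp: nn)
  also have "\<dots> = ennreal (\<Sum>n. mean_deviation m n / (real n + 1) ^ 3)"
    by (rule suminf_ennreal2[OF md0 summable_mean_deviation[OF m]])
  finally have "AE \<omega> in M. (\<Sum>n. ennreal (V n \<omega>)) \<noteq> \<infinity>"
    by (intro nn_integral_PInf_AE) auto
  then show ?thesis
    using inj AE_space
  proof eventually_elim
    case (elim \<omega>)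
    have "summable (\<lambda>n. V n \<omega>)"
      using elim(1) V0 by (intro summable_suminf_not_top) auto
    moreover have "V n \<omega> = deviation m n (\<lambda>k. U k \<omega>) / (real n + 1) ^ 3" for n
    proof -
      let ?x = "\<lambda>k. U k \<omega>"
      define \<rho> where "\<rho> i = (if i < n then key_rank ?x n i else i)" for i
      have \<rho>: "\<rho> permutes {..<n}"
        unfolding \<rho>_def using elim(2) by (intro key_rank_permutes) (auto intro: inj_on_subset)
      have ind: "indicator (E n \<pi>) \<omega> = (if \<pi> = \<rho> then 1 else 0 :: real)" if "\<pi> permutes {..<n}" for \<pi>
      proof -
        have "\<omega> \<in> E n \<pi> \<longleftrightarrow> \<pi> = \<rho>"
        proof
          assume "\<omega> \<in> E n \<pi>"
          then have "\<pi> i = \<rho> i" for i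
            using permutes_not_in[OF that, of i] by (cases "i < n") (auto simp: E_def \<rho>_def)
          then show "\<pi> = \<rho>" by auto
        qed (use elim(3) in \<open>auto simp: E_def \<rho>_def\<close>)
        then show ?thesis by (simp only: indicator_def of_bool_def)
      qed
      have "(\<Sum>\<pi>\<in>?Q n. deviation m n (\<lambda>i. real (\<pi> i)) * indicator (E n \<pi>) \<omega>)
         = (\<Sum>\<pi>\<in>?Q n. if \<pi> = \<rho> then deviation m n (\<lambda>i. real (\<pi> i)) else 0)"
        using ind by (intro sum.cong) auto
      also have "\<dots> = deviation m n (\<lambda>i. real (\<rho> i))"
        using fin \<rho> by (simp add: sum.delta)
      also have "\<dots> = deviation m n ?x"
        using key_rank_less_iff[of _ n _ ?x] by (intro deviation_order_iso) (auto simp: \<rho>_def)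
      finally show ?thesis by (simp add: V_def)
    qed
    ultimately show ?case by simp
  qed
qed

end

section \<open>Convergence along a fixed key sequence\<close>

lemma gapvec_tendsto:
  assumes m: "m \<ge> 2" and inj: "inj x" and sm: "summable (\<lambda>n. deviation m n x / (real n + 1) ^ 3)"
    and p: "p \<in> {1..2*m-2}"
  shows "(\<lambda>n. gapvec m x n p / real n) \<longlonglongrightarrow> limvec m (gap_type m p)"
proof -
  let ?v = "limvec m (gap_type m p)"
  define u where "u n = gapvec m x n p / (real n + 1) - ?v" for n
  \<comment> \<open>Replacing the keys by their ranks brings in \<open>gapvec_total\<close>; a
    single count is at most the total.\<close>
  have le: "gapvec m x n p \<le> real n + 1" if n: "n \<ge> 1" for n
  proof -
    define \<rho> where "\<rho> i = (if i < n then key_rank x n i else i)" for i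
    have \<rho>: "\<rho> permutes {..<n}"
      unfolding \<rho>_def using inj by (intro key_rank_permutes) (auto intro: inj_on_subset)
    have "gapvec m x n = gapvec m (\<lambda>i. real (\<rho> i)) n"
      using key_rank_less_iff[of _ n _ x] by (intro gapvec_order_iso) (auto simp: \<rho>_def)
    then show ?thesis
      using gapvec_total[OF m n \<rho>] member_le_sum[OF p, of "gapvec m x n"] by (simp add: gapvec_def)
  qed
  have "u \<longlonglongrightarrow> 0"
  proof (rule tendsto_zero_of_slow_variation)
    fix n :: nat assume n: "n \<ge> 1"
    obtain q where q: "gapvec m x (Suc n) p = gapvec m x n p + replacement m q p"
      using gapvec_step[OF m n, of x] p inj by (metis inj_on_subset top_greatest)
    let ?t = "real n + 1"
    \<comment> \<open>When \<open>X\<close> changes by \<open>r\<close> and the total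
      \<open>t\<close> by 1, the ratio changes by \<open>(r - X / t) / (t + 1)\<close>; here
      \<open>r\<close> is bounded by \<open>abs_replacement_le\<close> and \<open>X / t\<close> lies
      between 0 and 1.\<close>
    have "u (Suc n) - u n = (replacement m q p - gapvec m x n p / ?t) / (?t + 1)"
    proof -
      have "(g + r) / (t + 1) - g / t = (r - g / t) / (t + 1)" if "t > 0" for g r t :: real
        using that by (simp add: divide_simps) (simp add: algebra_simps)
      from this[of ?t "gapvec m x n p" "replacement m q p"] show ?thesis by (simp add: u_def q add_ac)
    qed
    then have "\<bar>u (Suc n) - u n\<bar> = \<bar>replacement m q p - gapvec m x n p / ?t\<bar> / (?t + 1)" by simp
    also have "\<dots> \<le> (2 * real m + 5) / ?t"
    proof (intro frac_le)
      have "0 \<le> gapvec m x n p / ?t" "gapvec m x n p / ?t \<le> 1"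
        using le[OF n] by (auto simp: gapvec_def)
      then show "\<bar>replacement m q p - gapvec m x n p / ?t\<bar> \<le> 2 * real m + 5"
        using abs_replacement_le[of m q p] by linarith
    qed auto
    finally show "\<bar>u (Suc n) - u n\<bar> \<le> (2 * real m + 5) / (real n + 1)" .
  next
    have v: "?v > 0" using limvec_pos[OF m p] .
    \<comment> \<open>One summand of the chi-square is \<open>(t u)^2 / v\<close> with
      \<open>t = n + 1\<close>; dividing by \<open>t^3\<close> leaves \<open>u^2 / t\<close> up to
      the factor \<open>v\<close>.\<close>
    have "(u n)\<^sup>2 / (real n + 1) \<le> ?v * (deviation m n x / (real n + 1) ^ 3)" for n
    proof -
      let ?t = "real n + 1"
      have "(gapvec m x n p - ?t * ?v)\<^sup>2 / ?v \<le> deviation m n x"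
        unfolding deviation_def chi_square_def using p limvec_pos[OF m]
        by (intro member_le_sum[where f="\<lambda>k. (gapvec m x n k - ?t * limvec m (gap_type m k))\<^sup>2 / limvec m (gap_type m k)"])
           (auto simp: less_imp_le)
      then have "(gapvec m x n p - ?t * ?v)\<^sup>2 \<le> ?v * deviation m n x"
        using v by (simp add: pos_divide_le_eq mult.commute)
      moreover have "gapvec m x n p - ?t * ?v = ?t * u n" by (simp add: u_def field_simps)
      ultimately have "?t\<^sup>2 * (u n)\<^sup>2 / ?t ^ 3 \<le> ?v * deviation m n x / ?t ^ 3"
        by (intro divide_right_mono) (auto simp: power_mult_distrib)
      moreover have "?t\<^sup>2 * (u n)\<^sup>2 / ?t ^ 3 = (u n)\<^sup>2 / ?t"
      proof -
        have "?t > 0" by simp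
        then show ?thesis by (simp add: power2_eq_square power3_eq_cube divide_simps)
      qed
      ultimately show ?thesis by simp
    qed
    then show "summable (\<lambda>n. (u n)\<^sup>2 / (real n + 1))"
      by (intro summable_comparison_test'[OF summable_mult[OF sm, of ?v], of 0]) auto
  qed
  \<comment> \<open>Passes from the normalisation by \<open>n + 1\<close> in \<open>u\<close> to the
    one by \<open>n\<close>.\<close>
  moreover have "(\<lambda>n. 1 + 1 / real n) \<longlonglongrightarrow> 1 + 0"
    by (intro tendsto_intros lim_1_over_n)
  ultimately have "(\<lambda>n. (u n + ?v) * (1 + 1 / real n)) \<longlonglongrightarrow> (0 + ?v) * (1 + 0)"
    by (intro tendsto_intros)
  moreover have "eventually (\<lambda>n. (u n + ?v) * (1 + 1 / real n) = gapvec m x n p / real n) sequentially"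
    using eventually_gt_at_top[of 0]
  proof eventually_elim
    case (elim n)
    then show ?case by (simp add: u_def divide_simps)
  qed
  ultimately show ?thesis by (simp add: tendsto_cong)
qed

theorem theorem1:
  fixes M :: "'a measure" and U :: "nat \<Rightarrow> 'a \<Rightarrow> real" and m :: nat
  assumes "prob_space M"
    and "m \<ge> 2"
    and "prob_space.indep_vars M (\<lambda>_. borel) U UNIV"
    and "\<And>k. distr M borel (U k) = uniform_measure lborel {0..1}"
  shows "AE \<omega> in M. \<forall>i\<in>{1..2*m-2}.
           (\<lambda>n. real (gaps m i (build m n (\<lambda>k. U k \<omega>))) / real n) \<longlonglongrightarrow> limvec m i"
proof -
  interpret prob_space M by fact
  \<comment> \<open>The uniform law has no atoms, so the keys are almost surely distinct.\<close>
  have inj: "AE \<omega> in M. inj (\<lambda>k. U k \<omega>)"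
  proof (rule AE_inj_of_indep[OF assms(3)])
    fix k and x :: real
    have "emeasure lborel ({0..1} \<inter> {x}) \<le> emeasure lborel {x}" by (intro emeasure_mono) auto
    then have "emeasure lborel ({0..1} \<inter> {x}) = 0" by simp
    then show "emeasure (distr M borel (U k)) {x} = 0"
      unfolding assms(4) by (subst emeasure_uniform_measure) auto
  qed
  from AE_summable_deviation[OF assms(2-4) inj] inj show ?thesis
  proof eventually_elim
    case (elim \<omega>)
    show ?case
    proof
      fix i assume i: "i \<in> {1..2*m-2}"
      \<comment> \<open>The inverse of \<open>gap_type\<close> on the levels
        \<open>1, ..., 2 m - 2\<close>.\<close>
      define p where "p = (if i \<le> m then 2 * m - 1 - i else i - m)"
      have "p \<in> {1..2*m-2}" "gap_type m p = i" using i \<open>m \<ge> 2\<close> by (auto simp: p_def gap_type_def)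
      then show "(\<lambda>n. real (gaps m i (build m n (\<lambda>k. U k \<omega>))) / real n) \<longlonglongrightarrow> limvec m i"
        using gapvec_tendsto[OF assms(2) elim(2,1), of p] by (simp add: gapvec_def)
    qed
  qed
qed

end
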